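(* There are infinitely many diagonal type groups $G$ with $\mathrm{RC}(G)=4$.
   Context: Diagonal type groups. Let $k\geqslant 2$ be an integer and $T$ a non-abelian finite simple group. Define $W_0=\{(\varphi_1,\dots,\varphi_k)\sigma\in \mathrm{Aut}(T)\wr \mathrm{S}_k : \mathrm{Inn}(T)\varphi_1=\mathrm{Inn}(T)\varphi_i \text{ for all } i\}$, $D_0=\{(\varphi,\dots,\varphi)\sigma : \varphi\in\mathrm{Aut}(T),\ \sigma\in \mathrm{S}_k\}\leqslant W_0$, and let $\Omega=[W_0:D_0]$ be the set of right cosets of $D_0$ in $W_0$, so $|\Omega|=|T|^{k-1}$. Then $W_0$ acts faithfully on $\Omega$ by right multiplication. Write $T^k$ for $\mathrm{Inn}(T)^k\leqslant W_0$. A subgroup $G$ of $\mathrm{Sym}(\Omega)$ is of diagonal type if, for some such $k$ and $T$, $T^k\trianglelefteq G\leqslant W_0$. Relational complexity. Let $G\leqslant \mathrm{Sym}(\Omega)$, let $s\leqslant t$ be positive integers, and let $\Lambda=(\lambda_1,\dots,\lambda_t),\Sigma=(\sigma_1,\dots,\sigma_t)\in\Omega^t$. Write $\Lambda\sim_s\Sigma$ if for every subset of $s$ indices $i_1,\dots,i_s$ there exists $g\in G$ such that $\lambda_{i_j}^g=\sigma_{i_j}$ for all $j\in\{1,\dots,s\}$. The relational complexity $\mathrm{RC}(G)$ is the smallest $s\geqslant 2$ such that for all $t\geqslant s$ and all $\Lambda,\Sigma\in\Omega^t$, if $\Lambda\sim_s\Sigma$ then $\Lambda\in\Sigma^G$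 (where $G$ acts coordinatewise on $\Omega^t$). *)

theory Defs
  imports "HOL-Algebra.Bij" "HOL-Algebra.SimpleGroups" "HOL-Algebra.Sym_Groups"
begin

section \<open>Diagonal type groups\<close>

text \<open>
  Automorphisms and permutations are composed from right to left, as in \<^const>\<open>AutoGroup\<close> and
  \<^const>\<open>sym_group\<close>. Compared with the composition of maps written on the right, every
  group is replaced by its opposite, and inverting the automorphisms and permutations
  identifies the two versions (right cosets being mapped to right cosets).
\<close>

definition Inn :: "('a, 'b) monoid_scheme \<Rightarrow> ('a \<Rightarrow> 'a) set" where
  "Inn T = (\<lambda>t. \<lambda>x\<in>carrier T. t \<otimes>\<^bsub>T\<^esub> x \<otimes>\<^bsub>T\<^esub> inv\<^bsub>T\<^esub> t) ` carrier T"

text \<open>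
  The pair \<open>(f, \<sigma>)\<close> stands for \<open>(f 1, \<dots>, f k)\<sigma>\<close>. The multiplication is that of the semidirect
  product in which \<open>\<sigma>\<close> moves the entry in position \<open>i\<close> to position \<open>\<sigma> i\<close>.
\<close>

definition wreath_sym ::
    "('a, 'b) monoid_scheme \<Rightarrow> nat \<Rightarrow> ((nat \<Rightarrow> 'a) \<times> (nat \<Rightarrow> nat)) monoid" where
  "wreath_sym A k =
    \<lparr>carrier = (\<Pi>\<^sub>E i\<in>{1..k}. carrier A) \<times> carrier (sym_group k),
     monoid.mult = \<lambda>(f, \<sigma>) (g, \<tau>). (\<lambda>i\<in>{1..k}. f i \<otimes>\<^bsub>A\<^esub> g (inv' \<sigma> i), \<sigma> \<otimes>\<^bsub>sym_group k\<^esub> \<tau>),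
     one = (\<lambda>i\<in>{1..k}. \<one>\<^bsub>A\<^esub>, \<one>\<^bsub>sym_group k\<^esub>)\<rparr>"

type_synonym 'a diag_elt = "(nat \<Rightarrow> 'a \<Rightarrow> 'a) \<times> (nat \<Rightarrow> nat)"

definition W0 :: "nat \<Rightarrow> ('a, 'b) monoid_scheme \<Rightarrow> 'a diag_elt monoid" where
  "W0 k T = (wreath_sym (AutoGroup T) k)
    \<lparr>carrier := {(f, \<sigma>) \<in> carrier (wreath_sym (AutoGroup T) k).
       \<forall>i\<in>{1..k}. Inn T #>\<^bsub>AutoGroup T\<^esub> f 1 = Inn T #>\<^bsub>AutoGroup T\<^esub> f i}\<rparr>"

definition D0 :: "nat \<Rightarrow> ('a, 'b) monoid_scheme \<Rightarrow> 'a diag_elt set" where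
  "D0 k T = {(\<lambda>i\<in>{1..k}. \<phi>, \<sigma>) | \<phi> \<sigma>. \<phi> \<in> carrier (AutoGroup T) \<and> \<sigma> \<in> carrier (sym_group k)}"

definition diag_points :: "nat \<Rightarrow> ('a, 'b) monoid_scheme \<Rightarrow> 'a diag_elt set set" where
  "diag_points k T = rcosets\<^bsub>W0 k T\<^esub> (D0 k T)"

text \<open>
  The permutation of the right cosets induced by right multiplication with \<open>w\<close>. Since
  \<^const>\<open>BijGroup\<close> composes from right to left, this map reverses products; the image of a
  subgroup of \<open>W0 k T\<close> is nevertheless the intended set of permutations.
\<close>

definition diag_perm ::
    "nat \<Rightarrow> ('a, 'b) monoid_scheme \<Rightarrow> 'a diag_elt \<Rightarrow> 'a diag_elt set \<Rightarrow> 'a diag_elt set" where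
  "diag_perm k T w = (\<lambda>C\<in>diag_points k T. C #>\<^bsub>W0 k T\<^esub> w)"

definition Tk :: "nat \<Rightarrow> ('a, 'b) monoid_scheme \<Rightarrow> 'a diag_elt set" where
  "Tk k T = (\<Pi>\<^sub>E i\<in>{1..k}. Inn T) \<times> {\<one>\<^bsub>sym_group k\<^esub>}"

text \<open>
  The groups \<open>T\<close> have their carrier in \<^typ>\<open>nat\<close>; every finite group is isomorphic to one of
  these. The library's \<^const>\<open>simple_group\<close> includes finiteness, as it requires an order
  greater than 1 and infinite groups have order 0.
\<close>

definition diagonal_type :: "nat diag_elt set set \<Rightarrow> (nat diag_elt set \<Rightarrow> nat diag_elt set) set \<Rightarrow> bool"
  where
  "diagonal_type \<Omega> G \<longleftrightarrow>
    (\<exists>(k::nat) (T::nat monoid).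
       k \<ge> 2 \<and> simple_group T \<and> finite (carrier T) \<and> \<not> comm_group T \<and>
       \<Omega> = diag_points k T \<and>
       subgroup G (BijGroup \<Omega>) \<and>
       (diag_perm k T ` Tk k T) \<lhd> (BijGroup \<Omega>)\<lparr>carrier := G\<rparr> \<and>
       G \<subseteq> diag_perm k T ` carrier (W0 k T))"


section \<open>Relational complexity\<close>

definition tuple_sim :: "('p \<Rightarrow> 'p) set \<Rightarrow> nat \<Rightarrow> 'p list \<Rightarrow> 'p list \<Rightarrow> bool" where
  "tuple_sim G s \<Lambda> \<Sigma> \<longleftrightarrow>
    (\<forall>I \<subseteq> {..<length \<Lambda>}. card I = s \<longrightarrow> (\<exists>g\<in>G. \<forall>i\<in>I. g (\<Lambda> ! i) = \<Sigma> ! i))"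

definition RC :: "'p set \<Rightarrow> ('p \<Rightarrow> 'p) set \<Rightarrow> nat" where
  "RC \<Omega> G = (LEAST s. s \<ge> 2 \<and>
    (\<forall>t \<ge> s. \<forall>\<Lambda> \<Sigma>. set \<Lambda> \<subseteq> \<Omega> \<and> set \<Sigma> \<subseteq> \<Omega> \<and> length \<Lambda> = t \<and> length \<Sigma> = t \<and>
       tuple_sim G s \<Lambda> \<Sigma> \<longrightarrow> (\<exists>g\<in>G. \<Lambda> = map g \<Sigma>)))"


section \<open>Isomorphism of permutation groups\<close>

definition perm_iso :: "(('p set \<times> ('p \<Rightarrow> 'p) set) \<times> ('p set \<times> ('p \<Rightarrow> 'p) set)) set" where
  "perm_iso = {((\<Omega>, G), (\<Omega>', G')).
     subgroup G (BijGroup \<Omega>) \<and> subgroup G' (BijGroup \<Omega>') \<and>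
     (\<exists>\<beta> \<theta>. bij_betw \<beta> \<Omega> \<Omega>' \<and>
        \<theta> \<in> iso ((BijGroup \<Omega>)\<lparr>carrier := G\<rparr>) ((BijGroup \<Omega>')\<lparr>carrier := G'\<rparr>) \<and>
        (\<forall>g\<in>G. \<forall>\<omega>\<in>\<Omega>. \<beta> (g \<omega>) = \<theta> g (\<beta> \<omega>)))}"

end

theory Submission
  imports Defs "HOL-Algebra.Algebraic_Closure_Type" "HOL-Library.Z2"
begin

text \<open>
  The witnesses are the groups \<open>G = T\<^sup>2\<close> for \<open>k = 2\<close> and \<open>T = SL\<^sub>2(q)\<close>, where \<open>q \<ge> 4\<close> is a power of 2.
  For \<open>k = 2\<close> the points correspond to the elements of \<open>T\<close>, and \<open>(a, b) \<in> T\<^sup>2\<close> acts by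
  \<open>t \<mapsto> inv a \<otimes> t \<otimes> b\<close> (lemma \<open>diag_point_mult_inn_pair\<close>).

  The value 4 of the relational complexity follows from two properties of \<open>T\<close>.

  \<^item> \<open>T\<close> is commutation transitive: centralizers of nontrivial elements are abelian. The point
    stabilizer is \<open>T\<close> acting on itself by conjugation, so the pointwise stabilizer of a set is an
    intersection of centralizers, and commutation transitivity implies that it is already
    the stabilizer of at most three of the points (lemma \<open>tuple_base_of_size_three\<close>). If two
    tuples are 4-equivalent, then an element that matches such a base matches every further
    entry, because base and entry together can be matched. So the relational complexity is at most 4.

  \<^item> \<open>T\<close> contains a symmetric group of degree 3. Two involutions \<open>x\<close>, \<open>y\<close> that generate it yield
    the tuples \<open>(1, x, y, y x)\<close> and \<open>(1, x, y, x y)\<close>, which are 3-equivalent but not equivalent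
    (lemma \<open>three_equivalent_inequivalent_tuples\<close>). So the relational complexity is at least 4.

  For \<open>SL\<^sub>2(q)\<close> with \<open>q\<close> even the first property holds because the centralizer of a nonscalar matrix
  consists of polynomials in that matrix, and the second one because \<open>SL\<^sub>2(2)\<close> is a symmetric group of
  degree 3. Simplicity is proved by the classical argument with transvections. As the degree of \<open>G\<close> is
  the order of \<open>T\<close>, the groups for different \<open>q\<close> fall into infinitely many isomorphism classes.
\<close>

section \<open>Bases and relational complexity\<close>

lemma tuple_sim_extend:
  assumes "tuple_sim G s \<Lambda> \<Sigma>" "s \<le> length \<Lambda>" "I \<subseteq> {..<length \<Lambda>}" "card I \<le> s"
  shows "\<exists>g\<in>G. \<forall>i\<in>I. g (\<Lambda> ! i) = \<Sigma> ! i"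
proof -
  obtain J where "I \<subseteq> J" "J \<subseteq> {..<length \<Lambda>}" "card J = s"
    using exists_subset_between[of I s "{..<length \<Lambda>}"] assms by auto
  moreover from this obtain g where "g \<in> G" "\<forall>i\<in>J. g (\<Lambda> ! i) = \<Sigma> ! i"
    using assms(1) unfolding tuple_sim_def by blast
  ultimately show ?thesis by blast
qed

text \<open>
  A relation that holds on all \<open>(s + 1)\<close>-subtuples extends to the whole tuple as soon as some \<open>s\<close>
  entries form a base for the tuple, that is, their images under a group element determine the
  images of all entries: the element that matches the base together with one further entry \<open>i\<close>
  then agrees at \<open>i\<close> with the element that was chosen for the base alone.
\<close>

lemma tuple_sim_base_imp_equiv:
  assumes sim: "tuple_sim G (Suc s) \<Lambda> \<Sigma>" "Suc s \<le> length \<Lambda>"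
    and J: "J \<subseteq> {..<length \<Lambda>}" "card J \<le> s"
    and base: "\<And>g h i. g \<in> G \<Longrightarrow> h \<in> G \<Longrightarrow> i < length \<Lambda> \<Longrightarrow> \<forall>j\<in>J. g (\<Lambda> ! j) = h (\<Lambda> ! j) \<Longrightarrow>
                g (\<Lambda> ! i) = h (\<Lambda> ! i)"
  shows "\<exists>g\<in>G. \<forall>i<length \<Lambda>. g (\<Lambda> ! i) = \<Sigma> ! i"
proof -
  obtain g where g: "g \<in> G" "\<forall>j\<in>J. g (\<Lambda> ! j) = \<Sigma> ! j"
    using tuple_sim_extend[OF sim J(1)] J(2) by auto
  have "g (\<Lambda> ! i) = \<Sigma> ! i" if i: "i < length \<Lambda>" for i
  proof -
    have "finite J" using J(1) finite_subset by blast
    then have "card (insert i J) \<le> Suc s" using J(2) by (simp add: card_insert_if)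
    then obtain h where h: "h \<in> G" "\<forall>j\<in>insert i J. h (\<Lambda> ! j) = \<Sigma> ! j"
      using tuple_sim_extend[OF sim, of "insert i J"] J(1) i by auto
    then show ?thesis using base[OF g(1) h(1) i] g(2) by simp
  qed
  then show ?thesis using g(1) by blast
qed

section \<open>Relational complexity of two-sided multiplication\<close>

text \<open>
  Equivalently, the centralizers of nontrivial elements are abelian.
\<close>

definition commutation_transitive :: "('a, 'b) monoid_scheme \<Rightarrow> bool" where
  "commutation_transitive T \<longleftrightarrow>
    (\<forall>x\<in>carrier T. \<forall>y\<in>carrier T. \<forall>z\<in>carrier T.
       z \<noteq> \<one>\<^bsub>T\<^esub> \<and> x \<otimes>\<^bsub>T\<^esub> z = z \<otimes>\<^bsub>T\<^esub> x \<and> y \<otimes>\<^bsub>T\<^esub> z = z \<otimes>\<^bsub>T\<^esub> y \<longrightarrow> x \<otimes>\<^bsub>T\<^esub> y = y \<otimes>\<^bsub>T\<^esub> x)"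

text \<open>
  The two generators satisfy the Coxeter relations of the symmetric group of degree 3; with
  \<open>x \<noteq> y\<close> they generate a copy of this group.
\<close>

definition S3_generators :: "('a, 'b) monoid_scheme \<Rightarrow> 'a \<Rightarrow> 'a \<Rightarrow> bool" where
  "S3_generators T x y \<longleftrightarrow> x \<in> carrier T \<and> y \<in> carrier T \<and> x \<noteq> y \<and>
     x \<otimes>\<^bsub>T\<^esub> x = \<one>\<^bsub>T\<^esub> \<and> y \<otimes>\<^bsub>T\<^esub> y = \<one>\<^bsub>T\<^esub> \<and> x \<otimes>\<^bsub>T\<^esub> y \<otimes>\<^bsub>T\<^esub> x = y \<otimes>\<^bsub>T\<^esub> x \<otimes>\<^bsub>T\<^esub> y"

lemma (in group) S3_generators_noncommuting:
  assumes "S3_generators G x y"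
  shows "x \<otimes> y \<noteq> y \<otimes> x"
proof
  assume eq: "x \<otimes> y = y \<otimes> x"
  have *: "x \<in> carrier G" "y \<in> carrier G" "x \<otimes> x = \<one>" "y \<otimes> y = \<one>" "x \<otimes> y \<otimes> x = y \<otimes> x \<otimes> y" "x \<noteq> y"
    using assms by (auto simp: S3_generators_def)
  have "x \<otimes> y \<otimes> x = y \<otimes> (x \<otimes> x)" using *(1,2) by (simp only: eq m_assoc m_closed)
  then have "x \<otimes> y \<otimes> x = y" using * by simp
  moreover have "y \<otimes> x \<otimes> y = x \<otimes> (y \<otimes> y)" using *(1,2) by (simp only: eq[symmetric] m_assoc m_closed)
  then have "y \<otimes> x \<otimes> y = x" using * by simp
  ultimately show False using * by simp
qed

text \<open>
  The relational complexity is computed for \<open>T \<times> T\<close> acting on \<open>T\<close> by left and right multiplication.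
  The labelling \<open>P\<close> of the points by elements of \<open>T\<close> serves to transfer the result to the cosets
  that are the points of the diagonal action.
\<close>

locale two_sided_action = group T for T (structure) +
  fixes P :: "'a \<Rightarrow> 'p" and \<Omega> :: "'p set" and G :: "('p \<Rightarrow> 'p) set"
  assumes points: "bij_betw P (carrier T) \<Omega>"
    and actE: "g \<in> G \<Longrightarrow> \<exists>a\<in>carrier T. \<exists>b\<in>carrier T. \<forall>t\<in>carrier T. g (P t) = P (inv a \<otimes> t \<otimes> b)"
    and actI: "a \<in> carrier T \<Longrightarrow> b \<in> carrier T \<Longrightarrow> \<exists>g\<in>G. \<forall>t\<in>carrier T. g (P t) = P (inv a \<otimes> t \<otimes> b)"
begin

lemma P_eq_iff: "s \<in> carrier T \<Longrightarrow> t \<in> carrier T \<Longrightarrow> P s = P t \<longleftrightarrow> s = t"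
  using points by (auto simp: bij_betw_def inj_on_def)

text \<open>
  After translating \<open>x\<close> to the identity, an element that fixes \<open>x\<close> is a conjugation. So once two
  elements of \<open>T \<times> T\<close> agree at \<open>x\<close>, agreement at any other \<open>y\<close> means that one element of \<open>T\<close>,
  independent of \<open>y\<close>, centralizes \<open>y \<otimes> inv x\<close>.
\<close>

lemma two_sided_agree_iff:
  assumes [simp]: "a \<in> carrier T" "b \<in> carrier T" "c \<in> carrier T" "d \<in> carrier T" "x \<in> carrier T" "y \<in> carrier T"
    and agree: "inv a \<otimes> x \<otimes> b = inv c \<otimes> x \<otimes> d"
  shows "inv a \<otimes> y \<otimes> b = inv c \<otimes> y \<otimes> d \<longleftrightarrow>
    (c \<otimes> inv a) \<otimes> (y \<otimes> inv x) = (y \<otimes> inv x) \<otimes> (c \<otimes> inv a)"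
proof -
  have solve: "inv a \<otimes> z \<otimes> b = inv c \<otimes> z \<otimes> d \<longleftrightarrow> (c \<otimes> inv a) \<otimes> z = z \<otimes> (d \<otimes> inv b)"
    if [simp]: "z \<in> carrier T" for z
  proof -
    have "(c \<otimes> inv a) \<otimes> z = z \<otimes> (d \<otimes> inv b) \<longleftrightarrow> c \<otimes> inv a \<otimes> z = (z \<otimes> d) \<otimes> inv b"
      by (simp add: m_assoc)
    also have "\<dots> \<longleftrightarrow> z \<otimes> d = c \<otimes> inv a \<otimes> z \<otimes> b"
      by (rule inv_solve_right) simp_all
    also have "\<dots> \<longleftrightarrow> z \<otimes> d = c \<otimes> (inv a \<otimes> z \<otimes> b)"
      by (simp add: m_assoc)
    also have "\<dots> \<longleftrightarrow> inv a \<otimes> z \<otimes> b = inv c \<otimes> z \<otimes> d"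
      by (simp add: inv_solve_left m_assoc)
    finally show ?thesis ..
  qed
  have "(c \<otimes> inv a) \<otimes> x = x \<otimes> (d \<otimes> inv b)" using agree solve by simp
  then have "d \<otimes> inv b = inv x \<otimes> ((c \<otimes> inv a) \<otimes> x)"
    by (simp add: inv_solve_left)
  then have "inv a \<otimes> y \<otimes> b = inv c \<otimes> y \<otimes> d \<longleftrightarrow> 
     (c \<otimes> inv a) \<otimes> y = y \<otimes> (inv x \<otimes> ((c \<otimes> inv a) \<otimes> x))"
    using solve by simp
  also have "\<dots> \<longleftrightarrow> (c \<otimes> inv a) \<otimes> y = (y \<otimes> inv x) \<otimes> (c \<otimes> inv a) \<otimes> x"
    by (simp add: m_assoc)
  also have "\<dots> \<longleftrightarrow> (c \<otimes> inv a) \<otimes> y \<otimes> inv x = (y \<otimes> inv x) \<otimes> (c \<otimes> inv a)"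
    by (simp add: inv_solve_right')
  finally show ?thesis by (simp add: m_assoc)
qed

text \<open>
  Under commutation transitivity the chain of stabilizers of a tuple has at most three steps: the
  stabilizer of the first entry is a copy of \<open>T\<close> acting by conjugation, the stabilizer of a further
  entry is the centralizer of a nontrivial element, which is abelian, and any two different such
  centralizers intersect trivially.
\<close>

lemma tuple_base_of_size_three:
  assumes CT: "commutation_transitive T" and x: "\<And>i. i < n \<Longrightarrow> x i \<in> carrier T" and "n > 0"
  obtains J where "J \<subseteq> {..<n}" "card J \<le> 3"
    and "\<And>g h i. g \<in> G \<Longrightarrow> h \<in> G \<Longrightarrow> i < n \<Longrightarrow> \<forall>j\<in>J. g (P (x j)) = h (P (x j)) \<Longrightarrow>
           g (P (x i)) = h (P (x i))"
proof -
  define u where "u i = x i \<otimes> inv x 0" for i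
  have u: "u i \<in> carrier T" if "i < n" for i using that x \<open>n > 0\<close> by (simp add: u_def)
  have base: "g (P (x i)) = h (P (x i))"
    if "g \<in> G" "h \<in> G" "i < n" "J \<subseteq> {..<n}" "0 \<in> J" "\<forall>j\<in>J. g (P (x j)) = h (P (x j))"
      and cent: "\<And>e. e \<in> carrier T \<Longrightarrow> \<forall>j\<in>J. e \<otimes> u j = u j \<otimes> e \<Longrightarrow> e \<otimes> u i = u i \<otimes> e"
    for g h i J
  proof -
    obtain a b where ab: "a \<in> carrier T" "b \<in> carrier T" "\<And>t. t \<in> carrier T \<Longrightarrow> g (P t) = P (inv a \<otimes> t \<otimes> b)"
      using actE[OF \<open>g \<in> G\<close>] by blast
    obtain c d where cd: "c \<in> carrier T" "d \<in> carrier T" "\<And>t. t \<in> carrier T \<Longrightarrow> h (P t) = P (inv c \<otimes> t \<otimes> d)"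
      using actE[OF \<open>h \<in> G\<close>] by blast
    have eq_iff: "g (P (x j)) = h (P (x j)) \<longleftrightarrow> inv a \<otimes> x j \<otimes> b = inv c \<otimes> x j \<otimes> d" if "j < n" for j
      using ab cd x[OF that] by (simp add: P_eq_iff)
    have "inv a \<otimes> x 0 \<otimes> b = inv c \<otimes> x 0 \<otimes> d"
      using eq_iff[OF \<open>n > 0\<close>] that by blast
    then have iff: "g (P (x j)) = h (P (x j)) \<longleftrightarrow> (c \<otimes> inv a) \<otimes> u j = u j \<otimes> (c \<otimes> inv a)" if "j < n" for j
      unfolding eq_iff[OF that] u_def using ab cd x that \<open>n > 0\<close> by (intro two_sided_agree_iff) auto
    have "\<forall>j\<in>J. (c \<otimes> inv a) \<otimes> u j = u j \<otimes> (c \<otimes> inv a)"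
      using iff \<open>J \<subseteq> {..<n}\<close> \<open>\<forall>j\<in>J. g (P (x j)) = h (P (x j))\<close> by blast
    then show ?thesis using cent[of "c \<otimes> inv a"] iff[OF \<open>i < n\<close>] ab cd by simp
  qed
  \<comment> \<open>All \<open>u i\<close> are trivial, or they commute with a nontrivial \<open>u i\<close>, or two of them do not commute.\<close>
  consider "\<forall>i<n. u i = \<one>"
    | i where "i < n" "u i \<noteq> \<one>" "\<forall>l<n. u l \<otimes> u i = u i \<otimes> u l"
    | i j where "i < n" "j < n" "u j \<otimes> u i \<noteq> u i \<otimes> u j"
    by blast
  then show ?thesis
  proof cases
    case 1
    have "e \<otimes> u i = u i \<otimes> e" if "e \<in> carrier T" "i < n" for e i
      using 1 that by simp
    then show ?thesis
      using that[of "{0}"] base[where J="{0}"] \<open>n > 0\<close> by fastforce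
  next
    case (2 i)
    have c: "e \<otimes> u l = u l \<otimes> e" if "e \<in> carrier T" "l < n" "\<forall>j\<in>{0, i}. e \<otimes> u j = u j \<otimes> e" for e l
      using CT[unfolded commutation_transitive_def, rule_format, of e "u l" "u i"] 2 that u by simp
    show ?thesis
    proof (rule that[of "{0, i}"])
      show "{0, i} \<subseteq> {..<n}" "card {0, i} \<le> 3" using 2 \<open>n > 0\<close> by (auto simp: card_insert_if)
      show "g (P (x l)) = h (P (x l))" 
        if "g \<in> G" "h \<in> G" "l < n" "\<forall>j\<in>{0, i}. g (P (x j)) = h (P (x j))" for g h l
        by (rule base[OF that(1-3) _ _ that(4)]) (use c[OF _ that(3)] 2(1) \<open>n > 0\<close> in blast)+
    qed
  next
    case (3 i j)
    have one: "e = \<one>" if "e \<in> carrier T" "\<forall>l\<in>{0, i, j}. e \<otimes> u l = u l \<otimes> e" for e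
      using CT[unfolded commutation_transitive_def, rule_format, of "u j" "u i" e] 3 that u by auto
    have c: "e \<otimes> u l = u l \<otimes> e" if "e \<in> carrier T" "l < n" "\<forall>j\<in>{0, i, j}. e \<otimes> u j = u j \<otimes> e" for e l
      using one[OF that(1,3)] that(2) u by simp
    show ?thesis
    proof (rule that[of "{0, i, j}"])
      show "{0, i, j} \<subseteq> {..<n}" "card {0, i, j} \<le> 3" using 3 \<open>n > 0\<close> by (auto simp: card_insert_if)
      show "g (P (x l)) = h (P (x l))" 
        if "g \<in> G" "h \<in> G" "l < n" "\<forall>j\<in>{0, i, j}. g (P (x j)) = h (P (x j))" for g h l
        by (rule base[OF that(1-3) _ _ that(4)]) (use c[OF _ that(3)] 3(1,2) \<open>n > 0\<close> in blast)+
    qed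
  qed
qed

lemma inverse_exists:
  assumes "g \<in> G"
  shows "\<exists>h\<in>G. \<forall>\<omega>\<in>\<Omega>. h (g \<omega>) = \<omega>"
proof -
  obtain a b where [simp]: "a \<in> carrier T" "b \<in> carrier T"
      and g: "\<And>t. t \<in> carrier T \<Longrightarrow> g (P t) = P (inv a \<otimes> t \<otimes> b)"
    using actE[OF assms] by blast
  obtain h where h: "h \<in> G" "\<And>t. t \<in> carrier T \<Longrightarrow> h (P t) = P (inv (inv a) \<otimes> t \<otimes> inv b)"
    using actI[of "inv a" "inv b"] by auto
  have "inv (inv a) \<otimes> (inv a \<otimes> t \<otimes> b) \<otimes> inv b = t" if [simp]: "t \<in> carrier T" for t
  proof -
    have "a \<otimes> (inv a \<otimes> t) = t" by (simp flip: m_assoc)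
    then show ?thesis by (simp add: m_assoc)
  qed
  then have "h (g (P t)) = P t" if "t \<in> carrier T" for t
    using that g h(2) by simp
  then show ?thesis using h(1) points unfolding bij_betw_def by blast
qed

lemma four_equivalent_imp_equivalent:
  assumes CT: "commutation_transitive T"
    and "set \<Lambda> \<subseteq> \<Omega>" "length \<Sigma> = length \<Lambda>" "4 \<le> length \<Lambda>" "tuple_sim G 4 \<Lambda> \<Sigma>"
  shows "\<exists>g\<in>G. \<Lambda> = map g \<Sigma>"
proof -
  define x where "x i = inv_into (carrier T) P (\<Lambda> ! i)" for i
  have P_x: "x i \<in> carrier T" "P (x i) = \<Lambda> ! i" if "i < length \<Lambda>" for i
    using that assms(2) points nth_mem[OF that] unfolding x_def bij_betw_def
    by (auto intro!: inv_into_into f_inv_into_f)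
  obtain J where J: "J \<subseteq> {..<length \<Lambda>}" "card J \<le> 3"
    and base: "\<And>g h i. g \<in> G \<Longrightarrow> h \<in> G \<Longrightarrow> i < length \<Lambda> \<Longrightarrow> \<forall>j\<in>J. g (P (x j)) = h (P (x j)) \<Longrightarrow>
           g (P (x i)) = h (P (x i))"
  proof (rule tuple_base_of_size_three[where n = "length \<Lambda>" and x = x])
    show "0 < length \<Lambda>" using assms(4) by linarith
  qed (use CT P_x(1) in blast)+
  have "\<exists>g\<in>G. \<forall>i<length \<Lambda>. g (\<Lambda> ! i) = \<Sigma> ! i"
  proof (rule tuple_sim_base_imp_equiv[of G 3])
    show "g (\<Lambda> ! i) = h (\<Lambda> ! i)"
      if "g \<in> G" "h \<in> G" "i < length \<Lambda>" "\<forall>j\<in>J. g (\<Lambda> ! j) = h (\<Lambda> ! j)" for g h i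
    proof -
      have "P (x j) = \<Lambda> ! j" if "j \<in> insert i J" for j using that \<open>i < length \<Lambda>\<close> J(1) P_x(2) by blast
      then show ?thesis using base[OF that(1-3)] that(4) by simp
    qed
  qed (use assms J in auto)
  then obtain g where g: "g \<in> G" "\<And>i. i < length \<Lambda> \<Longrightarrow> g (\<Lambda> ! i) = \<Sigma> ! i" by blast
  obtain h where h: "h \<in> G" "\<forall>\<omega>\<in>\<Omega>. h (g \<omega>) = \<omega>" using inverse_exists[OF g(1)] by blast
  have "\<Lambda> = map h \<Sigma>"
  proof (rule nth_equalityI)
    show "\<Lambda> ! i = map h \<Sigma> ! i" if "i < length \<Lambda>" for i
    proof -
      have "h (g (\<Lambda> ! i)) = \<Lambda> ! i" using nth_mem[OF that] assms(2) h(2) by blast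
      then show ?thesis using that g(2) assms(3) by simp
    qed
  qed (simp add: assms(3))
  then show ?thesis using h(1) by blast
qed

text \<open>
  In the symmetric group generated by \<open>x\<close> and \<open>y\<close>, compare \<open>(1, x, y, y x)\<close> with
  \<open>(1, x, y, x y)\<close>. Conjugation by \<open>x\<close> or \<open>y\<close> interchanges the two products, which are mutually
  inverse of order 3, and this handles the triples that consist of the identity, one generator and
  the product. No element matches all four entries, because fixing the identity, \<open>x\<close> and \<open>y\<close> forces it to be the conjugation by
  an element that centralizes \<open>x\<close> and \<open>y\<close>, and \<open>x y \<noteq> y x\<close>.
\<close>

lemma three_equivalent_inequivalent_tuples:
  assumes S3: "S3_generators T x y"
  obtains \<Lambda> \<Sigma> where "set \<Lambda> \<subseteq> \<Omega>" "set \<Sigma> \<subseteq> \<Omega>" "length \<Lambda> = 4" "length \<Sigma> = 4"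
    and "\<And>s. s \<le> 3 \<Longrightarrow> tuple_sim G s \<Lambda> \<Sigma>" and "\<not> (\<exists>g\<in>G. \<Lambda> = map g \<Sigma>)"
proof -
  have [simp]: "x \<in> carrier T" "y \<in> carrier T" and xx: "x \<otimes> x = \<one>" and yy: "y \<otimes> y = \<one>"
    and braid: "x \<otimes> y \<otimes> x = y \<otimes> x \<otimes> y"
    using S3 by (auto simp: S3_generators_def)
  let ?\<Lambda> = "[P \<one>, P x, P y, P (y \<otimes> x)]" and ?\<Sigma> = "[P \<one>, P x, P y, P (x \<otimes> y)]"
  have xx': "x \<otimes> (x \<otimes> z) = z" if "z \<in> carrier T" for z
    using that by (simp add: xx flip: m_assoc)
  have yy': "y \<otimes> (y \<otimes> z) = z" if "z \<in> carrier T" for z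
    using that by (simp add: yy flip: m_assoc)
  have braid1: "y \<otimes> (x \<otimes> y) = x \<otimes> (y \<otimes> x)" using braid by (simp add: m_assoc)
  have braid2: "y \<otimes> (x \<otimes> (y \<otimes> z)) = x \<otimes> (y \<otimes> (x \<otimes> z))" if "z \<in> carrier T" for z
    using braid that by (metis \<open>x \<in> carrier T\<close> \<open>y \<in> carrier T\<close> m_assoc m_closed)
  have [simp]: "inv x = x" "inv y = y" using xx yy by (simp_all add: inv_equality)
  note simps = m_assoc inv_mult_group xx xx' yy yy' braid1 braid2
  have points': "P t \<in> \<Omega>" if "t \<in> carrier T" for t using points that by (auto simp: bij_betw_def)
  have agree: "\<exists>g\<in>G. \<forall>i\<in>I. g (?\<Lambda> ! i) = ?\<Sigma> ! i" 
    if I: "I \<subseteq> {..<4}" "card I \<le> 3" for I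
  proof -
    have "I \<noteq> {..<4}" using I(2) by auto
    then obtain k where k: "k < 4" "k \<notin> I" using I(1) by auto
    have "\<exists>a\<in>carrier T. \<exists>b\<in>carrier T. \<forall>i<4. i \<noteq> k \<longrightarrow>
        inv a \<otimes> [\<one>, x, y, y \<otimes> x] ! i \<otimes> b = [\<one>, x, y, x \<otimes> y] ! i"
    proof -
      have all4: "(\<forall>i<4. Q i) \<longleftrightarrow> Q 0 \<and> Q 1 \<and> Q 2 \<and> Q (3::nat)" for Q
        by (auto simp: numeral_eq_Suc less_Suc_eq)
      consider "k = 0" | "k = 1" | "k = 2" | "k = 3" using k(1) by linarith
      then show ?thesis
      proof cases
        \<comment> \<open>Here the identity is left out. Matching \<open>x\<close> and \<open>y\<close> forces \<open>b = x a x = y a y\<close>, so \<open>a\<close> commutes with \<open>x y\<close>; its inverse \<open>a = y x\<close> works.\<close>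
        case 1 show ?thesis unfolding all4 1
          by (rule bexI[of _ "y \<otimes> x"], rule bexI[of _ "x \<otimes> y"]) (simp_all add: simps)
      next
        case 2 show ?thesis unfolding all4 2
          by (rule bexI[of _ y], rule bexI[of _ y]) (simp_all add: simps)
      next
        case 3 show ?thesis unfolding all4 3
          by (rule bexI[of _ x], rule bexI[of _ x]) (simp_all add: simps)
      next
        case 4 show ?thesis unfolding all4 4
          by (rule bexI[of _ \<one>], rule bexI[of _ \<one>]) (simp_all add: simps)
      qed
    qed
    then obtain a b where ab: "a \<in> carrier T" "b \<in> carrier T"
      "\<And>i. i < 4 \<Longrightarrow> i \<noteq> k \<Longrightarrow> inv a \<otimes> [\<one>, x, y, y \<otimes> x] ! i \<otimes> b = [\<one>, x, y, x \<otimes> y] ! i" by blast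
    obtain g where g: "g \<in> G" "\<And>t. t \<in> carrier T \<Longrightarrow> g (P t) = P (inv a \<otimes> t \<otimes> b)"
      using actI[OF ab(1,2)] by blast
    have "g (?\<Lambda> ! i) = ?\<Sigma> ! i" if "i \<in> I" for i
    proof -
      have i: "i < 4" "i \<noteq> k" using that I(1) k(2) by auto
      have "?\<Lambda> ! i = P ([\<one>, x, y, y \<otimes> x] ! i)" "?\<Sigma> ! i = P ([\<one>, x, y, x \<otimes> y] ! i)"
        using i(1) nth_map[of i "[\<one>, x, y, y \<otimes> x]" P] nth_map[of i "[\<one>, x, y, x \<otimes> y]" P] by simp_all
      moreover have "[\<one>, x, y, y \<otimes> x] ! i \<in> carrier T"
        using nth_mem[of i "[\<one>, x, y, y \<otimes> x]"] i(1) by auto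
      ultimately show ?thesis using g(2) ab(3)[OF i] by simp
    qed
    then show ?thesis using g(1) by blast
  qed
  show ?thesis
  proof (rule that[of ?\<Lambda> ?\<Sigma>])
    show "tuple_sim G s ?\<Lambda> ?\<Sigma>" if "s \<le> 3" for s
      unfolding tuple_sim_def using agree that by (auto simp: numeral_eq_Suc)
    show "\<not> (\<exists>g\<in>G. ?\<Lambda> = map g ?\<Sigma>)"
    proof
      assume "\<exists>g\<in>G. ?\<Lambda> = map g ?\<Sigma>"
      then obtain g where g: "g \<in> G" "?\<Lambda> = map g ?\<Sigma>" by (elim bexE)
      \<comment> \<open>Kept as a conjunction: as rewrite rules these equations would not terminate.\<close>
      note img = g(2)[unfolded list.map list.inject]
      obtain a b where [simp]: "a \<in> carrier T" "b \<in> carrier T"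
          and ab: "\<And>t. t \<in> carrier T \<Longrightarrow> g (P t) = P (inv a \<otimes> t \<otimes> b)"
        using actE[OF g(1)] by blast
      have transport: "inv a \<otimes> s \<otimes> b = t" if "P t = g (P s)" "s \<in> carrier T" "t \<in> carrier T" for s t
        using that P_eq_iff[of t "inv a \<otimes> s \<otimes> b"] ab[of s] by simp
      have eqs: "inv a \<otimes> \<one> \<otimes> b = \<one>" "inv a \<otimes> x \<otimes> b = x" "inv a \<otimes> y \<otimes> b = y"
          "inv a \<otimes> (x \<otimes> y) \<otimes> b = y \<otimes> x"
        by (rule transport[OF img[THEN conjunct1]]
              transport[OF img[THEN conjunct2, THEN conjunct1]]
              transport[OF img[THEN conjunct2, THEN conjunct2, THEN conjunct1]]
              transport[OF img[THEN conjunct2, THEN conjunct2, THEN conjunct2, THEN conjunct1]]; simp)+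
      have "b = a" using eqs(1) by (simp add: inv_solve_left')
      have x: "x \<otimes> a = a \<otimes> x" and y: "y \<otimes> a = a \<otimes> y"
        using eqs(2,3) by (simp_all add: \<open>b = a\<close> m_assoc inv_solve_left')
      have "x \<otimes> y \<otimes> a = a \<otimes> (y \<otimes> x)"
        using eqs(4) by (simp add: \<open>b = a\<close> m_assoc inv_solve_left')
      moreover have "x \<otimes> y \<otimes> a = a \<otimes> (x \<otimes> y)"
        by (metis x y m_assoc \<open>x \<in> carrier T\<close> \<open>y \<in> carrier T\<close> \<open>a \<in> carrier T\<close>)
      ultimately have "x \<otimes> y = y \<otimes> x" by simp
      then show False using S3_generators_noncommuting[OF S3] by simp
    qed
  qed (use points' in auto)
qed

theorem RC_eq_4:
  assumes "commutation_transitive T" "S3_generators T x y"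
  shows "RC \<Omega> G = 4"
  unfolding RC_def
proof (rule Least_equality)
  show "4 \<ge> (2::nat) \<and> (\<forall>t\<ge>4. \<forall>\<Lambda> \<Sigma>. set \<Lambda> \<subseteq> \<Omega> \<and> set \<Sigma> \<subseteq> \<Omega> \<and> length \<Lambda> = t \<and> length \<Sigma> = t \<and>
       tuple_sim G 4 \<Lambda> \<Sigma> \<longrightarrow> (\<exists>g\<in>G. \<Lambda> = map g \<Sigma>))"
    using four_equivalent_imp_equivalent[OF assms(1)] by auto
next
  fix s :: nat
  assume s: "s \<ge> 2 \<and> (\<forall>t\<ge>s. \<forall>\<Lambda> \<Sigma>. set \<Lambda> \<subseteq> \<Omega> \<and> set \<Sigma> \<subseteq> \<Omega> \<and> length \<Lambda> = t \<and> length \<Sigma> = t \<and>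
       tuple_sim G s \<Lambda> \<Sigma> \<longrightarrow> (\<exists>g\<in>G. \<Lambda> = map g \<Sigma>))"
  show "4 \<le> s"
  proof (rule ccontr)
    assume "\<not> 4 \<le> s"
    then have "s \<le> 3" by simp
    obtain \<Lambda> \<Sigma> where "set \<Lambda> \<subseteq> \<Omega>" "set \<Sigma> \<subseteq> \<Omega>" "length \<Lambda> = 4" "length \<Sigma> = 4"
      "tuple_sim G s \<Lambda> \<Sigma>" "\<not> (\<exists>g\<in>G. \<Lambda> = map g \<Sigma>)"
      using three_equivalent_inequivalent_tuples[OF assms(2)] \<open>s \<le> 3\<close> by metis
    moreover have "4 \<ge> s" using \<open>s \<le> 3\<close> by simp
    ultimately show False using s by blast
  qed
qed

end

section \<open>Diagonal type groups with two factors\<close>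

lemma (in group) normal_carrier: "carrier G \<lhd> G"
  by (rule normal_invI[OF subgroup_self]) simp

text \<open>
  When the centre is trivial, \<open>T\<close> is identified with \<open>Inn T\<close> by the map \<open>inn\<close> below. This makes the
  points of the diagonal action correspond to single elements of \<open>T\<close> when \<open>k = 2\<close>.
\<close>

locale centerless_group = group T for T (structure) +
  assumes center_trivial: "z \<in> carrier T \<Longrightarrow> (\<And>x. x \<in> carrier T \<Longrightarrow> x \<otimes> z = z \<otimes> x) \<Longrightarrow> z = \<one>"
begin

abbreviation "A \<equiv> AutoGroup T"

definition inn :: "'a \<Rightarrow> 'a \<Rightarrow> 'a" where
  "inn t = (\<lambda>x\<in>carrier T. t \<otimes> x \<otimes> inv t)"

sublocale A: group A by (rule AutoGroup)

lemma Inn_eq: "Inn T = inn ` carrier T"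
  by (simp add: Inn_def inn_def[abs_def])

lemma A_carrier: "carrier A = auto T"
  by (simp add: AutoGroup_def)

lemma A_mult: "\<phi> \<in> carrier A \<Longrightarrow> \<psi> \<in> carrier A \<Longrightarrow> \<phi> \<otimes>\<^bsub>A\<^esub> \<psi> = compose (carrier T) \<phi> \<psi>"
  by (simp add: AutoGroup_def BijGroup_def auto_def)

lemma A_one: "\<one>\<^bsub>A\<^esub> = (\<lambda>x\<in>carrier T. x)"
  by (simp add: AutoGroup_def BijGroup_def)

lemma A_hom: "\<phi> \<in> carrier A \<Longrightarrow> \<phi> \<in> hom T T"
  by (simp add: A_carrier auto_def)

lemma A_closed: "\<phi> \<in> carrier A \<Longrightarrow> x \<in> carrier T \<Longrightarrow> \<phi> x \<in> carrier T"
  using A_hom hom_in_carrier by metis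

lemma conj_conj:
  assumes [simp]: "t \<in> carrier T" "s \<in> carrier T" "x \<in> carrier T"
  shows "t \<otimes> (s \<otimes> x \<otimes> inv s) \<otimes> inv t = (t \<otimes> s) \<otimes> x \<otimes> inv (t \<otimes> s)"
  by (simp add: m_assoc inv_mult_group)

lemma inn_closed [simp, intro]:
  assumes [simp]: "t \<in> carrier T"
  shows "inn t \<in> carrier A"
proof -
  have *: "inv t \<otimes> (t \<otimes> x) = x" "t \<otimes> (inv t \<otimes> x) = x" if "x \<in> carrier T" for x
    using that by (simp_all flip: m_assoc)
  have "inn t \<in> hom T T"
    by (rule homI) (simp_all add: inn_def m_assoc *)
  moreover have "bij_betw (inn t) (carrier T) (carrier T)"
    by (rule bij_betw_byWitness[where f' = "\<lambda>x. inv t \<otimes> x \<otimes> t"]) (auto simp: inn_def m_assoc *)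
  ultimately show ?thesis
    by (simp add: A_carrier auto_def Bij_def inn_def)
qed

lemma inn_mult: "s \<in> carrier T \<Longrightarrow> t \<in> carrier T \<Longrightarrow> inn s \<otimes>\<^bsub>A\<^esub> inn t = inn (s \<otimes> t)"
  by (simp add: A_mult compose_def) (auto simp: inn_def conj_conj)

lemma inn_one: "inn \<one> = \<one>\<^bsub>A\<^esub>"
  by (auto simp: inn_def A_one)

lemma inn_inv: "t \<in> carrier T \<Longrightarrow> inv\<^bsub>A\<^esub> (inn t) = inn (inv t)"
  by (rule A.inv_equality) (simp_all add: inn_mult inn_one)

lemma inn_eq_iff:
  assumes [simp]: "s \<in> carrier T" "t \<in> carrier T"
  shows "inn s = inn t \<longleftrightarrow> s = t"
proof
  assume eq: "inn s = inn t"
  have "inv t \<otimes> s = \<one>"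
  proof (rule center_trivial)
    fix x assume [simp]: "x \<in> carrier T"
    have "inn (inv t \<otimes> s) = \<one>\<^bsub>A\<^esub>"
      using eq by (simp add: inn_mult[symmetric] inn_inv[symmetric])
    then have "inn (inv t \<otimes> s) x = x" by (simp add: A_one)
    then have "(inv t \<otimes> s) \<otimes> x \<otimes> inv (inv t \<otimes> s) = x" by (simp add: inn_def)
    then show "x \<otimes> (inv t \<otimes> s) = (inv t \<otimes> s) \<otimes> x"
      using inv_solve_right'[of x "(inv t \<otimes> s) \<otimes> x" "inv t \<otimes> s"] by simp
  qed simp
  then show "s = t" using inv_solve_left'[of \<one> t s] by simp
qed simp

lemma auto_inn_commute:
  assumes \<phi>: "\<phi> \<in> carrier A" and t [simp]: "t \<in> carrier T"
  shows "\<phi> \<otimes>\<^bsub>A\<^esub> inn t = inn (\<phi> t) \<otimes>\<^bsub>A\<^esub> \<phi>"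
proof -
  note [simp] = A_closed[OF \<phi>]
  have "\<phi> (t \<otimes> x \<otimes> inv t) = \<phi> t \<otimes> \<phi> x \<otimes> inv (\<phi> t)" if [simp]: "x \<in> carrier T" for x
    using hom_mult[OF A_hom[OF \<phi>]] group_hom.hom_inv[of T T \<phi> t] A_hom[OF \<phi>]
    by (simp add: group_hom_def group_hom_axioms_def)
  then show ?thesis
    using \<phi> by (simp add: A_mult compose_def) (auto simp: inn_def intro!: restrict_ext)
qed

lemma inn_auto_commute:
  assumes \<phi>: "\<phi> \<in> carrier A" and t: "t \<in> carrier T"
  obtains s where "s \<in> carrier T" "inn t \<otimes>\<^bsub>A\<^esub> \<phi> = \<phi> \<otimes>\<^bsub>A\<^esub> inn s"
proof -
  have "\<phi> ` carrier T = carrier T" using \<phi> by (auto simp: A_carrier auto_def Bij_def bij_betw_def)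
  then obtain s where "s \<in> carrier T" "\<phi> s = t" using t by (metis imageE)
  then show ?thesis using that auto_inn_commute[OF \<phi>] by metis
qed

lemma subgroup_Inn: "subgroup (Inn T) A"
  by (rule A.subgroupI) (auto simp: Inn_eq inn_inv inn_mult)

text \<open>
  Since \<open>Inn T\<close> is normal, its right cosets are also left cosets; left cosets are the convenient
  form, because \<open>D0\<close> acts on the entries by multiplication from the left.
\<close>

lemma W0_carrier_iff:
  "(f, \<sigma>) \<in> carrier (W0 k T) \<longleftrightarrow> f \<in> (\<Pi>\<^sub>E i\<in>{1..k}. carrier A) \<and> \<sigma> permutes {1..k} \<and>
     (\<forall>i\<in>{1..k}. \<forall>j\<in>{1..k}. \<exists>t\<in>carrier T. f j = f i \<otimes>\<^bsub>A\<^esub> inn t)"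
proof -
  have "(\<forall>i\<in>{1..k}. Inn T #>\<^bsub>A\<^esub> f 1 = Inn T #>\<^bsub>A\<^esub> f i) \<longleftrightarrow>
     (\<forall>i\<in>{1..k}. \<forall>j\<in>{1..k}. \<exists>t\<in>carrier T. f j = f i \<otimes>\<^bsub>A\<^esub> inn t)"
    if f: "f \<in> (\<Pi>\<^sub>E i\<in>{1..k}. carrier A)"
  proof -
    have same_coset_iff: "Inn T #>\<^bsub>A\<^esub> f i = Inn T #>\<^bsub>A\<^esub> f j \<longleftrightarrow> (\<exists>t\<in>carrier T. f j = f i \<otimes>\<^bsub>A\<^esub> inn t)"
      if ij: "i \<in> {1..k}" "j \<in> {1..k}" for i j
    proof
      have A: "f i \<in> carrier A" "f j \<in> carrier A" using f ij by auto
      {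
        assume "Inn T #>\<^bsub>A\<^esub> f i = Inn T #>\<^bsub>A\<^esub> f j"
        then have "f j \<in> Inn T #>\<^bsub>A\<^esub> f i" using A.rcos_self[OF A(2) subgroup_Inn] by simp
        then obtain t where "t \<in> carrier T" "f j = inn t \<otimes>\<^bsub>A\<^esub> f i" by (auto simp: r_coset_def Inn_eq)
        then show "\<exists>t\<in>carrier T. f j = f i \<otimes>\<^bsub>A\<^esub> inn t" by (metis inn_auto_commute[OF A(1)])
      next
        assume "\<exists>t\<in>carrier T. f j = f i \<otimes>\<^bsub>A\<^esub> inn t"
        then obtain t where "t \<in> carrier T" "f j = inn (f i t) \<otimes>\<^bsub>A\<^esub> f i"
          using auto_inn_commute[OF A(1)] by metis
        then have "f j \<in> Inn T #>\<^bsub>A\<^esub> f i" using A_closed[OF A(1)] by (auto simp: r_coset_def Inn_eq)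
        then show "Inn T #>\<^bsub>A\<^esub> f i = Inn T #>\<^bsub>A\<^esub> f j"
          using A.repr_independence A(1) subgroup_Inn by metis
      }
    qed
    have "(\<forall>i\<in>{1..k}. Inn T #>\<^bsub>A\<^esub> f 1 = Inn T #>\<^bsub>A\<^esub> f i) \<longleftrightarrow>
      (\<forall>i\<in>{1..k}. \<forall>j\<in>{1..k}. Inn T #>\<^bsub>A\<^esub> f i = Inn T #>\<^bsub>A\<^esub> f j)"
      by (cases k) (force, metis atLeastAtMost_iff le_refl One_nat_def Suc_le_mono zero_le)
    then show ?thesis using same_coset_iff by simp
  qed
  then show ?thesis
    by (auto simp: W0_def wreath_sym_def sym_group_def)
qed

lemma W0_mult:
  "(f, \<sigma>) \<otimes>\<^bsub>W0 k T\<^esub> (g, \<tau>) = (\<lambda>i\<in>{1..k}. f i \<otimes>\<^bsub>A\<^esub> g (inv' \<sigma> i), \<sigma> \<circ> \<tau>)"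
  by (simp add: W0_def wreath_sym_def sym_group_def)

text \<open>
  Left multiplication of \<open>(f, \<sigma>)\<close> by an element \<open>(\<phi>, \<dots>, \<phi>)\<tau>\<close> of \<open>D0\<close> permutes the two entries
  along with \<open>\<sigma>\<close> and multiplies both by \<open>\<phi>\<close> from the left. Hence the quotient of \<open>f (\<sigma> 1)\<close> and
  \<open>f (\<sigma> 2)\<close> is an invariant of the coset. It is an inner automorphism \<open>inn t\<close>, and this \<open>t\<close> is the
  label of the coset. The definition collects all pairs with invariant \<open>t\<close>, without reference to a
  representative.
\<close>

definition diag_point :: "'a \<Rightarrow> 'a diag_elt set" where
  "diag_point t = {(f, \<sigma>). f \<in> (\<Pi>\<^sub>E i\<in>{1..2}. carrier A) \<and> \<sigma> permutes {1..2} \<and>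
     f (\<sigma> 2) = f (\<sigma> 1) \<otimes>\<^bsub>A\<^esub> inn t}"

lemma perm_two:
  assumes s: "\<sigma> permutes {1..2::nat}"
  shows "\<sigma> 1 \<in> {1..2} \<and> \<sigma> 2 \<in> {1..2} \<and> {1..2} = {\<sigma> 1, \<sigma> 2} \<and> inv' \<sigma> (\<sigma> i) = i \<and> \<sigma> (inv' \<sigma> i) = i"
proof -
  have "{1..2} = {1, 2::nat}" by auto
  then show ?thesis using permutes_in_image[OF s] permutes_image[OF s] permutes_inverses[OF s] by auto
qed

lemma perm_two_mem: "\<sigma> permutes {1..2::nat} \<Longrightarrow> \<sigma> 1 \<in> {1..2} \<and> \<sigma> 2 \<in> {1..2}"
  by (simp only: permutes_in_image) simp

lemma D0_coset:
  assumes w: "(f, \<tau>) \<in> carrier (W0 2 T)" and t: "t \<in> carrier T" "f (\<tau> 2) = f (\<tau> 1) \<otimes>\<^bsub>A\<^esub> inn t"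
  shows "D0 2 T #>\<^bsub>W0 2 T\<^esub> (f, \<tau>) = diag_point t"
proof
  have f: "f \<in> (\<Pi>\<^sub>E i\<in>{1..2}. carrier A)" and \<tau>: "\<tau> permutes {1..2}"
    using w unfolding W0_carrier_iff by blast+
  note \<tau>' = perm_two[OF \<tau>]
  have f': "f i \<in> carrier A" if "i \<in> {1..2}" for i using f that by auto
  show "D0 2 T #>\<^bsub>W0 2 T\<^esub> (f, \<tau>) \<subseteq> diag_point t"
  proof
    fix v assume "v \<in> D0 2 T #>\<^bsub>W0 2 T\<^esub> (f, \<tau>)"
    then obtain \<phi> \<sigma> where \<phi>: "\<phi> \<in> carrier A" and \<sigma>: "\<sigma> permutes {1..2}"
      and v: "v = (\<lambda>i\<in>{1..2}. \<phi> \<otimes>\<^bsub>A\<^esub> f (inv' \<sigma> i), \<sigma> \<circ> \<tau>)"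
      by (auto simp: r_coset_def D0_def W0_mult sym_group_def cong: restrict_cong)
    have m: "inv' \<sigma> i \<in> {1..2}" if "i \<in> {1..2}" for i
      using permutes_in_image[OF permutes_inv[OF \<sigma>]] that by blast
    show "v \<in> diag_point t"
      unfolding diag_point_def v
      using perm_two[OF \<sigma>] permutes_in_image[OF \<sigma>] \<phi> t \<tau>' f' m permutes_compose[OF \<tau> \<sigma>]
      by (auto simp: A.m_assoc permutes_inverses[OF \<sigma>])
  qed
  show "diag_point t \<subseteq> D0 2 T #>\<^bsub>W0 2 T\<^esub> (f, \<tau>)"
  proof
    fix v assume "v \<in> diag_point t"
    then obtain g \<rho> where v: "v = (g, \<rho>)" and g: "g \<in> (\<Pi>\<^sub>E i\<in>{1..2}. carrier A)" and \<rho>: "\<rho> permutes {1..2}"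
      and gt: "g (\<rho> 2) = g (\<rho> 1) \<otimes>\<^bsub>A\<^esub> inn t"
      by (auto simp: diag_point_def)
    note \<rho>' = perm_two[OF \<rho>]
    have [simp]: "g (\<rho> 1) \<in> carrier A" "g (\<rho> 2) \<in> carrier A" "f (\<tau> 1) \<in> carrier A" "f (\<tau> 2) \<in> carrier A"
      using PiE_mem[OF g] PiE_mem[OF f] perm_two_mem[OF \<rho>] perm_two_mem[OF \<tau>] by blast+
    \<comment> \<open>The only candidate that carries the entry of \<open>f\<close> at \<open>\<tau> 1\<close> to that of \<open>g\<close> at \<open>\<rho> 1\<close>.\<close>
    define \<phi> where "\<phi> = g (\<rho> 1) \<otimes>\<^bsub>A\<^esub> inv\<^bsub>A\<^esub> (f (\<tau> 1))"
    define \<sigma> where "\<sigma> = \<rho> \<circ> inv' \<tau>"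
    have \<sigma>: "\<sigma> permutes {1..2}" unfolding \<sigma>_def using permutes_compose[OF permutes_inv[OF \<tau>] \<rho>] .
    have inv_\<sigma>: "inv' \<sigma> (\<rho> i) = \<tau> i" for i
      using permutes_inverses[OF \<sigma>] permutes_inverses[OF \<tau>] unfolding \<sigma>_def by (metis comp_apply)
    have \<phi>: "\<phi> \<in> carrier A" by (simp add: \<phi>_def del: One_nat_def)
    have "(\<lambda>i\<in>{1..2}. \<phi>, \<sigma>) \<otimes>\<^bsub>W0 2 T\<^esub> (f, \<tau>) = (g, \<rho>)"
    proof -
      have "\<sigma> \<circ> \<tau> = \<rho>" using permutes_inverses[OF \<tau>] by (auto simp: \<sigma>_def)
      moreover have "(\<lambda>i\<in>{1..2}. (\<lambda>i\<in>{1..2}. \<phi>) i \<otimes>\<^bsub>A\<^esub> f (inv' \<sigma> i)) = g"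
      proof (rule extensionalityI[where A = "{1..2}"])
        fix i :: nat assume "i \<in> {1..2}"
        then have "i \<in> {\<rho> 1, \<rho> 2}" using \<rho>' by blast
        moreover have "\<phi> \<otimes>\<^bsub>A\<^esub> f (\<tau> 1) = g (\<rho> 1)"
          by (simp add: \<phi>_def A.m_assoc del: One_nat_def)
        moreover have "\<phi> \<otimes>\<^bsub>A\<^esub> f (\<tau> 2) = g (\<rho> 2)"
        proof -
          have "\<phi> \<otimes>\<^bsub>A\<^esub> f (\<tau> 2) = (\<phi> \<otimes>\<^bsub>A\<^esub> f (\<tau> 1)) \<otimes>\<^bsub>A\<^esub> inn t"
            using t(1) \<phi> by (simp add: t(2) A.m_assoc del: One_nat_def)
          then show ?thesis using gt \<open>\<phi> \<otimes>\<^bsub>A\<^esub> f (\<tau> 1) = g (\<rho> 1)\<close> by (simp del: One_nat_def)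
        qed
        ultimately show "(\<lambda>i\<in>{1..2}. (\<lambda>i\<in>{1..2}. \<phi>) i \<otimes>\<^bsub>A\<^esub> f (inv' \<sigma> i)) i = g i"
          using inv_\<sigma> \<rho>' by auto
      qed (use g in \<open>auto simp: PiE_def\<close>)
      ultimately show ?thesis by (simp add: W0_mult)
    qed
    then show "v \<in> D0 2 T #>\<^bsub>W0 2 T\<^esub> (f, \<tau>)"
      unfolding v r_coset_def D0_def using \<phi> \<sigma> by (force simp: sym_group_def)
  qed
qed

definition inn_pair :: "'a \<Rightarrow> 'a \<Rightarrow> 'a diag_elt" where
  "inn_pair a b = (\<lambda>i\<in>{1..2}. inn (if i = 1 then a else b), id)"

lemma inn_pair_in_W0:
  assumes "a \<in> carrier T" "b \<in> carrier T"
  shows "inn_pair a b \<in> carrier (W0 2 T)"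
proof -
  have "\<exists>t\<in>carrier T. inn d = inn c \<otimes>\<^bsub>A\<^esub> inn t" if "c \<in> carrier T" "d \<in> carrier T" for c d
    using that by (intro bexI[of _ "inv c \<otimes> d"]) (auto simp: inn_mult simp flip: m_assoc)
  moreover have "(if i = 1 then a else b) \<in> carrier T" for i :: nat using assms by simp
  ultimately show ?thesis
    unfolding inn_pair_def W0_carrier_iff by (simp add: permutes_id del: if_split)
qed

lemma Tk_2: "Tk 2 T = {inn_pair a b | a b. a \<in> carrier T \<and> b \<in> carrier T}"
proof (intro equalityI subsetI)
  fix w assume "w \<in> Tk 2 T"
  then obtain f where w: "w = (f, id)" and f: "f \<in> (\<Pi>\<^sub>E i\<in>{1..2}. Inn T)"
    by (auto simp: Tk_def sym_group_def)
  then have "f 1 \<in> Inn T" "f 2 \<in> Inn T" by auto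
  then obtain a b where ab: "a \<in> carrier T" "b \<in> carrier T" "f 1 = inn a" "f 2 = inn b"
    unfolding Inn_eq by auto
  have "f = (\<lambda>i\<in>{1..2}. inn (if i = 1 then a else b))"
  proof (rule extensionalityI[where A = "{1..2}"])
    fix i :: nat assume "i \<in> {1..2}"
    then have "i = 1 \<or> i = 2" by auto
    then show "f i = (\<lambda>i\<in>{1..2}. inn (if i = 1 then a else b)) i" using ab by auto
  qed (use f in \<open>auto simp: PiE_def\<close>)
  then show "w \<in> {inn_pair a b | a b. a \<in> carrier T \<and> b \<in> carrier T}"
    using ab w by (auto simp: inn_pair_def)
next
  fix w assume "w \<in> {inn_pair a b | a b. a \<in> carrier T \<and> b \<in> carrier T}"
  then show "w \<in> Tk 2 T" by (auto simp: Tk_def inn_pair_def sym_group_def Inn_eq)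
qed

lemma inn_pair_one_in_diag_point: "t \<in> carrier T \<Longrightarrow> inn_pair \<one> t \<in> diag_point t"
  by (auto simp: inn_pair_def diag_point_def permutes_id inn_one)

lemma diag_point_eq_iff:
  assumes "s \<in> carrier T" "t \<in> carrier T"
  shows "diag_point s = diag_point t \<longleftrightarrow> s = t"
proof
  assume "diag_point s = diag_point t"
  then have "inn_pair \<one> s \<in> diag_point t" using inn_pair_one_in_diag_point assms by blast
  then show "s = t" using assms by (simp add: inn_pair_def diag_point_def inn_one inn_eq_iff)
qed simp

lemma diag_points_eq: "diag_points 2 T = diag_point ` carrier T"
proof
  show "diag_points 2 T \<subseteq> diag_point ` carrier T"
  proof
    fix C assume "C \<in> diag_points 2 T"
    then obtain f \<tau> where w: "(f, \<tau>) \<in> carrier (W0 2 T)" and C: "C = D0 2 T #>\<^bsub>W0 2 T\<^esub> (f, \<tau>)"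
      by (auto simp: diag_points_def RCOSETS_def)
    have "\<tau> permutes {1..2}" using w unfolding W0_carrier_iff by blast
    then obtain t where "t \<in> carrier T" "f (\<tau> 2) = f (\<tau> 1) \<otimes>\<^bsub>A\<^esub> inn t"
      using w perm_two unfolding W0_carrier_iff by blast
    then show "C \<in> diag_point ` carrier T" using D0_coset[OF w] C by blast
  qed
  show "diag_point ` carrier T \<subseteq> diag_points 2 T"
  proof
    fix C assume "C \<in> diag_point ` carrier T"
    then obtain t where t: "t \<in> carrier T" "C = diag_point t" by blast
    have "D0 2 T #>\<^bsub>W0 2 T\<^esub> inn_pair \<one> t = diag_point t"
      using D0_coset[of "fst (inn_pair \<one> t)" id t] inn_pair_in_W0[of \<one> t] t(1)
      by (simp add: inn_pair_def inn_one)
    then show "C \<in> diag_points 2 T"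
      using t inn_pair_in_W0[of \<one> t] by (auto simp: diag_points_def RCOSETS_def)
  qed
qed

lemma bij_diag_point: "bij_betw diag_point (carrier T) (diag_points 2 T)"
  by (auto simp: bij_betw_def inj_on_def diag_point_eq_iff diag_points_eq)

text \<open>
  The action of \<open>T\<^sup>2\<close> by two-sided multiplication: right multiplication by \<open>(inn a, inn b)\<close> changes the
  quotient of the two entries from \<open>inn t\<close> to \<open>inn (inv a) \<circ> inn t \<circ> inn b\<close>.
\<close>

lemma diag_point_mult_inn_pair:
  assumes t [simp]: "t \<in> carrier T" and a [simp]: "a \<in> carrier T" and b [simp]: "b \<in> carrier T"
  shows "diag_point t #>\<^bsub>W0 2 T\<^esub> inn_pair a b = diag_point (inv a \<otimes> t \<otimes> b)"
proof -
  let ?p = "\<lambda>a b i. inn (if i = (1::nat) then a else b)"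
  have sub: "diag_point t #>\<^bsub>W0 2 T\<^esub> inn_pair a b \<subseteq> diag_point (inv a \<otimes> t \<otimes> b)"
    if [simp]: "t \<in> carrier T" "a \<in> carrier T" "b \<in> carrier T" for t a b
  proof
    fix v assume "v \<in> diag_point t #>\<^bsub>W0 2 T\<^esub> inn_pair a b"
    then obtain f \<sigma> where f: "f \<in> (\<Pi>\<^sub>E i\<in>{1..2}. carrier A)" and \<sigma>: "\<sigma> permutes {1..2}"
      and ft: "f (\<sigma> 2) = f (\<sigma> 1) \<otimes>\<^bsub>A\<^esub> inn t" and v: "v = (f, \<sigma>) \<otimes>\<^bsub>W0 2 T\<^esub> inn_pair a b"
      by (auto simp: r_coset_def diag_point_def)
    note \<sigma>' = perm_two[OF \<sigma>]
    have inv_mem: "inv' \<sigma> i \<in> {1..2}" if "i \<in> {1..2}" for i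
      using permutes_in_image[OF permutes_inv[OF \<sigma>]] that by blast
    have v_eq: "v = (\<lambda>i\<in>{1..2}. f i \<otimes>\<^bsub>A\<^esub> ?p a b (inv' \<sigma> i), \<sigma>)"
      unfolding v inn_pair_def W0_mult using inv_mem by (auto intro!: restrict_ext)
    have [simp]: "f (\<sigma> 1) \<in> carrier A" using PiE_mem[OF f] perm_two_mem[OF \<sigma>] by blast
    have "f (\<sigma> 2) \<otimes>\<^bsub>A\<^esub> inn b = f (\<sigma> 1) \<otimes>\<^bsub>A\<^esub> inn a \<otimes>\<^bsub>A\<^esub> inn (inv a \<otimes> t \<otimes> b)"
    proof -
      have "a \<otimes> (inv a \<otimes> (t \<otimes> b)) = t \<otimes> b" by (simp flip: m_assoc)
      then show ?thesis by (simp add: ft A.m_assoc inn_mult m_assoc del: One_nat_def)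
    qed
    moreover have "f i \<in> carrier A" if "i \<in> {1..2}" for i using f that by auto
    ultimately show "v \<in> diag_point (inv a \<otimes> t \<otimes> b)"
      unfolding v_eq diag_point_def using \<sigma> \<sigma>' by (auto simp: permutes_inverses[OF \<sigma>])
  qed
  show ?thesis
  proof
    show "diag_point (inv a \<otimes> t \<otimes> b) \<subseteq> diag_point t #>\<^bsub>W0 2 T\<^esub> inn_pair a b"
    proof
      fix v assume v: "v \<in> diag_point (inv a \<otimes> t \<otimes> b)"
      \<comment> \<open>The reverse inclusion is the first one for the inverse pair.\<close>
      define u where "u = v \<otimes>\<^bsub>W0 2 T\<^esub> inn_pair (inv a) (inv b)"
      have "a \<otimes> (inv a \<otimes> t) = t" by (simp flip: m_assoc)
      then have "u \<in> diag_point t"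
        using sub[of "inv a \<otimes> t \<otimes> b" "inv a" "inv b"] v
        unfolding u_def r_coset_def by (auto simp: m_assoc)
      moreover have "u \<otimes>\<^bsub>W0 2 T\<^esub> inn_pair a b = v"
      proof -
        obtain g \<rho> where v_eq: "v = (g, \<rho>)" and g: "g \<in> (\<Pi>\<^sub>E i\<in>{1..2}. carrier A)" and \<rho>: "\<rho> permutes {1..2}"
          using v by (auto simp: diag_point_def)
        have inv_mem: "inv' \<rho> i \<in> {1..2}" if "i \<in> {1..2}" for i
          using permutes_in_image[OF permutes_inv[OF \<rho>]] that by blast
        have "(\<lambda>i\<in>{1..2}. g i \<otimes>\<^bsub>A\<^esub> ?p (inv a) (inv b) (inv' \<rho> i) \<otimes>\<^bsub>A\<^esub> ?p a b (inv' \<rho> i)) = g"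
        proof (rule extensionalityI[where A = "{1..2}"])
          fix i :: nat assume i: "i \<in> {1..2}"
          then have "g i \<in> carrier A" by (rule PiE_mem[OF g])
          then show "(\<lambda>i\<in>{1..2}. g i \<otimes>\<^bsub>A\<^esub> ?p (inv a) (inv b) (inv' \<rho> i) \<otimes>\<^bsub>A\<^esub> ?p a b (inv' \<rho> i)) i = g i"
            using i by (auto simp: A.m_assoc inn_mult inn_one)
        qed (use g in \<open>auto simp: PiE_def\<close>)
        moreover have "u \<otimes>\<^bsub>W0 2 T\<^esub> inn_pair a b =
            (\<lambda>i\<in>{1..2}. g i \<otimes>\<^bsub>A\<^esub> ?p (inv a) (inv b) (inv' \<rho> i) \<otimes>\<^bsub>A\<^esub> ?p a b (inv' \<rho> i), \<rho>)"
          unfolding u_def v_eq inn_pair_def W0_mult using inv_mem by (auto intro!: restrict_ext)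
        ultimately show ?thesis by (simp add: v_eq)
      qed
      ultimately show "v \<in> diag_point t #>\<^bsub>W0 2 T\<^esub> inn_pair a b" by (auto simp: r_coset_def)
    qed
  qed (use sub in simp)
qed

lemma diag_perm_inn_pair:
  assumes "a \<in> carrier T" "b \<in> carrier T" "t \<in> carrier T"
  shows "diag_perm 2 T (inn_pair a b) (diag_point t) = diag_point (inv a \<otimes> t \<otimes> b)"
  using assms by (simp add: diag_perm_def diag_points_eq diag_point_mult_inn_pair)

abbreviation "Tk_perms \<equiv> diag_perm 2 T ` Tk 2 T"

lemma Tk_permsE:
  assumes "g \<in> Tk_perms"
  obtains a b where "a \<in> carrier T" "b \<in> carrier T" "g = diag_perm 2 T (inn_pair a b)"
  using assms unfolding Tk_2 by blast

lemma Tk_permsI: "a \<in> carrier T \<Longrightarrow> b \<in> carrier T \<Longrightarrow> diag_perm 2 T (inn_pair a b) \<in> Tk_perms"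
  unfolding Tk_2 by blast

text \<open>
  The order of the factors is reversed, since right multiplications are composed from right to left.
\<close>

lemma diag_perm_inn_pair_comp:
  assumes [simp]: "a \<in> carrier T" "b \<in> carrier T" "c \<in> carrier T" "d \<in> carrier T"
  shows "compose (diag_points 2 T) (diag_perm 2 T (inn_pair a b)) (diag_perm 2 T (inn_pair c d)) =
    diag_perm 2 T (inn_pair (c \<otimes> a) (d \<otimes> b))"
proof (rule extensionalityI[where A = "diag_points 2 T"])
  fix C assume "C \<in> diag_points 2 T"
  then obtain t where "t \<in> carrier T" "C = diag_point t" by (auto simp: diag_points_eq)
  moreover from this have "C \<in> diag_points 2 T" by (simp add: diag_points_eq)
  ultimately show "compose (diag_points 2 T) (diag_perm 2 T (inn_pair a b)) (diag_perm 2 T (inn_pair c d)) C =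
      diag_perm 2 T (inn_pair (c \<otimes> a) (d \<otimes> b)) C"
    by (simp add: compose_eq diag_perm_inn_pair m_assoc inv_mult_group)
qed (simp_all add: diag_perm_def)

lemma diag_perm_inn_pair_one: "diag_perm 2 T (inn_pair \<one> \<one>) = (\<lambda>C\<in>diag_points 2 T. C)"
proof (rule extensionalityI[where A = "diag_points 2 T"])
  fix C assume C: "C \<in> diag_points 2 T"
  then obtain t where "t \<in> carrier T" "C = diag_point t" by (auto simp: diag_points_eq)
  with C show "diag_perm 2 T (inn_pair \<one> \<one>) C = (\<lambda>C\<in>diag_points 2 T. C) C" by (simp add: diag_perm_inn_pair)
qed (simp_all add: diag_perm_def)

lemma diag_perm_inn_pair_Bij:
  assumes [simp]: "a \<in> carrier T" "b \<in> carrier T"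
  shows "diag_perm 2 T (inn_pair a b) \<in> Bij (diag_points 2 T)"
proof -
  have c: "a \<otimes> (inv a \<otimes> t) = t" "inv a \<otimes> (a \<otimes> t) = t" if "t \<in> carrier T" for t
    using that by (simp_all flip: m_assoc)
  have "bij_betw (diag_perm 2 T (inn_pair a b)) (diag_points 2 T) (diag_points 2 T)"
    by (rule bij_betw_byWitness[where f' = "diag_perm 2 T (inn_pair (inv a) (inv b))"])
      (auto simp: diag_points_eq diag_perm_inn_pair m_assoc c)
  then show ?thesis by (simp add: Bij_def diag_perm_def)
qed

lemma subgroup_Tk_perms: "subgroup Tk_perms (BijGroup (diag_points 2 T))"
proof -
  interpret B: group "BijGroup (diag_points 2 T)" by (rule group_BijGroup)
  have mult: "diag_perm 2 T (inn_pair a b) \<otimes>\<^bsub>BijGroup (diag_points 2 T)\<^esub> diag_perm 2 T (inn_pair c d) =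
      diag_perm 2 T (inn_pair (c \<otimes> a) (d \<otimes> b))"
    if "a \<in> carrier T" "b \<in> carrier T" "c \<in> carrier T" "d \<in> carrier T" for a b c d
    using that by (simp add: BijGroup_def diag_perm_inn_pair_Bij diag_perm_inn_pair_comp)
  have closed: "diag_perm 2 T (inn_pair a b) \<in> carrier (BijGroup (diag_points 2 T))"
    if "a \<in> carrier T" "b \<in> carrier T" for a b
    using that by (simp add: BijGroup_def diag_perm_inn_pair_Bij)
  show ?thesis
  proof (rule B.subgroupI)
    show "Tk_perms \<subseteq> carrier (BijGroup (diag_points 2 T))"
      by (rule subsetI, erule Tk_permsE) (simp add: closed)
    show "Tk_perms \<noteq> {}" using Tk_permsI[OF one_closed one_closed] by (metis empty_iff)
  next
    fix g assume "g \<in> Tk_perms"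
    then obtain a b where ab: "a \<in> carrier T" "b \<in> carrier T" "g = diag_perm 2 T (inn_pair a b)"
      by (rule Tk_permsE)
    have "inv\<^bsub>BijGroup (diag_points 2 T)\<^esub> g = diag_perm 2 T (inn_pair (inv a) (inv b))"
      using ab closed by (intro B.inv_equality) (simp_all add: mult diag_perm_inn_pair_one, simp add: BijGroup_def)
    then show "inv\<^bsub>BijGroup (diag_points 2 T)\<^esub> g \<in> Tk_perms" using ab Tk_permsI by simp
  next
    fix g h assume "g \<in> Tk_perms" "h \<in> Tk_perms"
    then show "g \<otimes>\<^bsub>BijGroup (diag_points 2 T)\<^esub> h \<in> Tk_perms"
      by (elim Tk_permsE) (simp add: mult Tk_permsI)
  qed
qed

lemma normal_Tk_perms: "Tk_perms \<lhd> (BijGroup (diag_points 2 T))\<lparr>carrier := Tk_perms\<rparr>"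
proof -
  interpret G: group "(BijGroup (diag_points 2 T))\<lparr>carrier := Tk_perms\<rparr>"
    using subgroup.subgroup_is_group[OF subgroup_Tk_perms group_BijGroup] .
  show ?thesis using G.normal_carrier by simp
qed

lemma Tk_perms_subset: "Tk_perms \<subseteq> diag_perm 2 T ` carrier (W0 2 T)"
  using inn_pair_in_W0 unfolding Tk_2 by blast

end

section \<open>Finite fields of characteristic 2\<close>

text \<open>
  The polynomial \<open>X\<^sup>q - X\<close> with \<open>q = 2\<^sup>n\<close> has derivative \<open>-1\<close>, so it has no multiple roots, and over an
  algebraically closed field it has as many roots as its degree says.
\<close>

lemma card_fixed_points_frobenius_power:
  fixes n :: nat
  assumes char: "CHAR('a :: alg_closed_field) = 2" and "n > 0"
  shows "card {x :: 'a. x ^ (2 ^ n) = x} = 2 ^ n"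
proof -
  define q :: nat where "q = 2 ^ n"
  define p :: "'a poly" where "p = monom 1 q - monom 1 1"
  have q: "q > 1" using \<open>n > 0\<close> one_less_power[of "2::nat" n] by (simp add: q_def)
  have deg: "degree p = q"
    unfolding p_def diff_conv_add_uminus using q by (subst degree_add_eq_left) (auto simp: degree_monom_eq)
  have two: "(2::'a) = 0"
    using of_nat_CHAR[where ?'a='a] char by simp
  have q0: "of_nat q = (0::'a)"
    using \<open>n > 0\<close> by (simp add: q_def two)
  have pderiv: "pderiv p = -1"
    by (simp add: p_def pderiv_diff pderiv_monom q0 flip: one_poly_eq_simps)
  obtain A where A: "size A = degree p" "p = smult (lead_coeff p) (\<Prod>x\<in>#A. [:-x, 1:])"
    using alg_closed_imp_factorization[of p] deg q by fastforce
  have "p \<noteq> 0" using deg q by auto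
  have roots: "{x. poly p x = 0} = {x. x ^ q = x}"
    by (simp add: p_def poly_monom)
  have A_eq: "set_mset A = {x. poly p x = 0}"
    using \<open>p \<noteq> 0\<close> by (subst A(2)) (auto simp: poly_prod_mset prod_mset_zero_iff)
  \<comment> \<open>A double root would be a root of the derivative.\<close>
  have "count A a \<le> 1" for a
  proof (rule ccontr)
    assume "\<not> count A a \<le> 1"
    then have "{#a, a#} \<subseteq># A"
      by (intro mset_subset_eqI) (auto split: if_splits)
    then obtain B where "A = {#a, a#} + B" by (metis subset_mset.less_eqE)
    then obtain r where "p = [:-a, 1:] * ([:-a, 1:] * r)"
      using A(2) by (metis (no_types, lifting) add_mset_add_single image_mset_add_mset
          mult_smult_right prod_mset.add_mset union_mset_add_mset_left empty_neutral(1))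
    then have "poly (pderiv p) a = 0" by (simp add: pderiv_mult del: mult_pCons_left)
    with pderiv show False by simp
  qed
  then have "size A = card (set_mset A)"
    by (simp add: size_multiset_overloaded_eq) (metis count_greater_zero_iff le_antisym Suc_leI card_eq_sum sum.cong One_nat_def)
  then show ?thesis
    using A(1) A_eq deg roots by (simp add: q_def)
qed

text \<open>
  Finite fields of different orders appear as subsets of one fixed field, since the order of a field
  that is a type cannot vary within a statement.
\<close>

locale char_two_subfield =
  fixes F :: "'a :: field set"
  assumes one_add_one: "1 + 1 = (0 :: 'a)"
    and zero_mem: "0 \<in> F" and one_mem: "1 \<in> F"
    and add_mem: "x \<in> F \<Longrightarrow> y \<in> F \<Longrightarrow> x + y \<in> F"
    and mult_mem: "x \<in> F \<Longrightarrow> y \<in> F \<Longrightarrow> x * y \<in> F"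
    and inverse_mem: "x \<in> F \<Longrightarrow> inverse x \<in> F"

lemma frobenius_fixed_points_subfield:
  assumes char: "CHAR('a :: field) = 2"
  shows "char_two_subfield {x :: 'a. x ^ (2 ^ n) = x}"
proof
  show "1 + 1 = (0::'a)"
    using of_nat_CHAR[where ?'a='a] char by simp
  show "x + y \<in> {x. x ^ 2 ^ n = x}" if "x \<in> {x :: 'a. x ^ 2 ^ n = x}" "y \<in> {x. x ^ 2 ^ n = x}" for x y
    using that freshmans_dream'[of "2^n" n x y] char by simp
qed (auto simp: power_mult_distrib power_inverse)

section \<open>Two-dimensional special linear groups in characteristic 2\<close>

text \<open>
  The quadruple \<open>(a, b, c, d)\<close> is the matrix with rows \<open>(a, b)\<close> and \<open>(c, d)\<close>. The determinant is
  written with a plus sign, so that this is the special linear group in characteristic 2 only. There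
  the scalar matrices of determinant 1 are trivial, and the group coincides with the projective one.
\<close>

definition SL2 :: "'a :: field set \<Rightarrow> ('a \<times> 'a \<times> 'a \<times> 'a) monoid" where
  "SL2 F =
    \<lparr>carrier = {(a, b, c, d). a \<in> F \<and> b \<in> F \<and> c \<in> F \<and> d \<in> F \<and> a * d + b * c = 1},
     monoid.mult = \<lambda>(a, b, c, d) (a', b', c', d').
       (a * a' + b * c', a * b' + b * d', c * a' + d * c', c * b' + d * d'),
     one = (1, 0, 0, 1)\<rparr>"

context char_two_subfield
begin

lemma minus_eq: "- x = x" for x :: 'a
  using one_add_one by (metis add_eq_0_iff mult_1 mult_minus1)

lemma add_self: "x + x = 0" for x :: 'a
  by (metis minus_eq add.right_inverse)

lemma two_eq_zero: "(2 :: 'a) = 0"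
  using one_add_one by simp

lemma SL2_mult [simp]:
  "(a, b, c, d) \<otimes>\<^bsub>SL2 F\<^esub> (a', b', c', d') =
    (a * a' + b * c', a * b' + b * d', c * a' + d * c', c * b' + d * d')"
  by (simp add: SL2_def)

lemma SL2_one: "\<one>\<^bsub>SL2 F\<^esub> = (1, 0, 0, 1)"
  by (simp add: SL2_def)

lemma SL2_carrier:
  "(a, b, c, d) \<in> carrier (SL2 F) \<longleftrightarrow> a \<in> F \<and> b \<in> F \<and> c \<in> F \<and> d \<in> F \<and> a * d + b * c = 1"
  by (simp add: SL2_def)

lemma det_mult:
  fixes a b c d a' b' c' d' :: 'a
  shows "(a * a' + b * c') * (c * b' + d * d') + (a * b' + b * d') * (c * a' + d * c') =
   (a * d + b * c) * (a' * d' + b' * c')"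
  by (simp add: algebra_simps two_eq_zero)

lemma SL2_left_inverse:
  assumes "(a, b, c, d) \<in> carrier (SL2 F)"
  shows "(d, b, c, a) \<in> carrier (SL2 F)" "(d, b, c, a) \<otimes>\<^bsub>SL2 F\<^esub> (a, b, c, d) = \<one>\<^bsub>SL2 F\<^esub>"
  using assms by (auto simp: SL2_carrier SL2_one algebra_simps add_self)

lemma group_SL2: "group (SL2 F)"
proof (rule groupI)
  show "\<exists>y\<in>carrier (SL2 F). y \<otimes>\<^bsub>SL2 F\<^esub> x = \<one>\<^bsub>SL2 F\<^esub>" if "x \<in> carrier (SL2 F)" for x
    using that SL2_left_inverse by (cases x) blast
  show "x \<otimes>\<^bsub>SL2 F\<^esub> y \<in> carrier (SL2 F)" if "x \<in> carrier (SL2 F)" "y \<in> carrier (SL2 F)" for x y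
    using that by (cases x, cases y) (auto simp: SL2_carrier det_mult add_mem mult_mem)
qed (auto simp: SL2_carrier SL2_one zero_mem one_mem distrib_left distrib_right mult_ac add_ac)

lemma SL2_inv: "(a, b, c, d) \<in> carrier (SL2 F) \<Longrightarrow> inv\<^bsub>SL2 F\<^esub> (a, b, c, d) = (d, b, c, a)"
  using SL2_left_inverse group.inv_equality[OF group_SL2] by blast

lemma add_eq_zero_iff: "x + y = 0 \<longleftrightarrow> x = y" for x y :: 'a
  by (metis add_self add_left_cancel)

text \<open>
  Two matrices commute if and only if their traceless parts are parallel; in characteristic 2 the
  relevant coordinates are \<open>b\<close>, \<open>c\<close> and \<open>a + d\<close>.
\<close>

lemma SL2_commute_iff:
  "(a, b, c, d) \<otimes>\<^bsub>SL2 F\<^esub> (a', b', c', d') = (a', b', c', d') \<otimes>\<^bsub>SL2 F\<^esub> (a, b, c, d) \<longleftrightarrow>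
    b * c' = c * b' \<and> (a + d) * b' = b * (a' + d') \<and> (a + d) * c' = c * (a' + d')"
proof -
  have 1: "a * a' + b * c' = a' * a + b' * c \<longleftrightarrow> b * c' = c * b'"
    by (simp add: mult.commute)
  have 2: "c * b' + d * d' = c' * b + d' * d \<longleftrightarrow> b * c' = c * b'"
    by (auto simp: mult.commute)
  have 3: "a * b' + b * d' = a' * b + b' * d \<longleftrightarrow> (a + d) * b' = b * (a' + d')"
  proof -
    have "(a * b' + b * d') + (a' * b + b' * d) = (a + d) * b' + b * (a' + d')"
      by (simp add: algebra_simps)
    then show ?thesis by (metis add_eq_zero_iff)
  qed
  have 4: "c * a' + d * c' = c' * a + d' * c \<longleftrightarrow> (a + d) * c' = c * (a' + d')"
  proof -
    have "(c * a' + d * c') + (c' * a + d' * c) = (a + d) * c' + c * (a' + d')"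
      by (simp add: algebra_simps)
    then show ?thesis by (metis add_eq_zero_iff)
  qed
  show ?thesis
    unfolding SL2_mult prod.inject 1 2 3 4 by blast
qed

lemma SL2_nonscalar:
  assumes "(a, b, c, d) \<in> carrier (SL2 F)" "(a, b, c, d) \<noteq> \<one>\<^bsub>SL2 F\<^esub>"
  shows "b \<noteq> 0 \<or> c \<noteq> 0 \<or> a + d \<noteq> 0"
proof (rule ccontr)
  assume "\<not> ?thesis"
  then have "b = 0" "c = 0" "a = d" by (auto simp: add_eq_zero_iff)
  with assms have "a * a = 1" "a \<noteq> 1" by (auto simp: SL2_carrier SL2_one)
  moreover have "(a + 1) * (a + 1) = a * a + 1" by (simp add: algebra_simps two_eq_zero)
  ultimately show False using one_add_one by (auto simp: add_eq_zero_iff)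
qed

text \<open>
  Being parallel to a fixed nonzero vector \<open>(q, r, w)\<close> is the same as being a multiple of it, so any
  two vectors with this property are parallel to each other.
\<close>

lemma parallel_trans:
  fixes b c u b' c' v q r w :: 'a
  assumes "b * r = c * q" "u * q = b * w" "u * r = c * w"
    and "b' * r = c' * q" "v * q = b' * w" "v * r = c' * w"
    and "q \<noteq> 0 \<or> r \<noteq> 0 \<or> w \<noteq> 0"
  shows "b * c' = c * b' \<and> u * b' = b * v \<and> u * c' = c * v"
proof -
  consider "q \<noteq> 0" | "r \<noteq> 0" | "w \<noteq> 0" using assms(7) by blast
  then show ?thesis
  proof cases
    case 1
    then have "c = b * r / q" "u = b * w / q" "c' = b' * r / q" "v = b' * w / q"
      using assms by (simp_all add: eq_divide_eq)
    then show ?thesis by (simp add: mult_ac)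
  next
    case 2
    then have "b = c * q / r" "u = c * w / r" "b' = c' * q / r" "v = c' * w / r"
      using assms by (simp_all add: eq_divide_eq)
    then show ?thesis by (simp add: mult_ac)
  next
    case 3
    then have "b = u * q / w" "c = u * r / w" "b' = v * q / w" "c' = v * r / w"
      using assms by (simp_all add: eq_divide_eq)
    then show ?thesis by (simp add: mult_ac)
  qed
qed

lemma commutation_transitive_SL2: "commutation_transitive (SL2 F)"
  unfolding commutation_transitive_def
proof (intro ballI impI, elim conjE)
  fix x y z
  assume *: "x \<in> carrier (SL2 F)" "y \<in> carrier (SL2 F)" "z \<in> carrier (SL2 F)" "z \<noteq> \<one>\<^bsub>SL2 F\<^esub>"
    "x \<otimes>\<^bsub>SL2 F\<^esub> z = z \<otimes>\<^bsub>SL2 F\<^esub> x" "y \<otimes>\<^bsub>SL2 F\<^esub> z = z \<otimes>\<^bsub>SL2 F\<^esub> y"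
  obtain a b c d where x: "x = (a, b, c, d)" by (cases x)
  obtain a' b' c' d' where y: "y = (a', b', c', d')" by (cases y)
  obtain p q r s where z: "z = (p, q, r, s)" by (cases z)
  have nz: "q \<noteq> 0 \<or> r \<noteq> 0 \<or> p + s \<noteq> 0" using SL2_nonscalar * z by blast
  define u v w where "u = a + d" and "v = a' + d'" and "w = p + s"
  have "b * r = c * q" "u * q = b * w" "u * r = c * w"
    "b' * r = c' * q" "v * q = b' * w" "v * r = c' * w"
    using * unfolding x y z SL2_commute_iff u_def v_def w_def by auto
  moreover have "q \<noteq> 0 \<or> r \<noteq> 0 \<or> w \<noteq> 0" using nz w_def by simp
  ultimately have "b * c' = c * b' \<and> u * b' = b * v \<and> u * c' = c * v"
    by (rule parallel_trans)
  then show "x \<otimes>\<^bsub>SL2 F\<^esub> y = y \<otimes>\<^bsub>SL2 F\<^esub> x"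
    unfolding x y SL2_commute_iff u_def v_def .
qed

lemma divide_mem: "x \<in> F \<Longrightarrow> y \<in> F \<Longrightarrow> x / y \<in> F"
  by (simp add: divide_inverse mult_mem inverse_mem)

lemmas F_closed = zero_mem one_mem add_mem mult_mem divide_mem

text \<open>
  The commutator of a transvection with a triangular matrix is again a transvection. Its parameter is
  a fixed multiple of the given one, by the factor \<open>1 + v\<^sup>2 = (1 + v)\<^sup>2\<close>, which vanishes only if the
  diagonal is trivial.
\<close>

lemma normal_triangular_imp_transvections:
  assumes "N \<lhd> SL2 F" "(u, 0, s, v) \<in> N" "u \<noteq> 1" "t \<in> F"
  shows "(1, 0, t, 1) \<in> N"
proof -
  interpret normal N "SL2 F" by fact
  have L: "(u, 0, s, v) \<in> carrier (SL2 F)" using assms subset by blast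
  then have F: "u \<in> F" "s \<in> F" "v \<in> F" and uv: "u * v = 1" by (auto simp: SL2_carrier)
  have "v \<noteq> 1" using uv \<open>u \<noteq> 1\<close> by auto
  then have nz: "1 + v * v \<noteq> 0"
    using square_eq_1_iff[of v] by (auto simp: add_eq_zero_iff minus_eq)
  define r where "r = t / (1 + v * v)"
  have r: "r \<in> F" using F assms by (simp add: r_def F_closed)
  have E: "(1, 0, r, 1) \<in> carrier (SL2 F)" using r by (simp add: SL2_carrier F_closed)
  have "(1, 0, r, 1) \<otimes>\<^bsub>SL2 F\<^esub> (u, 0, s, v) \<otimes>\<^bsub>SL2 F\<^esub> inv\<^bsub>SL2 F\<^esub> (1, 0, r, 1) \<otimes>\<^bsub>SL2 F\<^esub> inv\<^bsub>SL2 F\<^esub> (u, 0, s, v) \<in> N"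
    using inv_op_closed2[OF E assms(2)] assms(2) by blast
  moreover have "(r * u + s + v * r) * v + v * s = t"
  proof -
    have "(r * u + s + v * r) * v + v * s = r * (u * v + v * v) + (s * v + s * v)"
      by (simp add: algebra_simps)
    also have "\<dots> = t" using nz by (simp add: uv add_self r_def)
    finally show ?thesis .
  qed
  ultimately show ?thesis
    using uv by (simp add: SL2_inv[OF E] SL2_inv[OF L] mult.commute)
qed

text \<open>
  A matrix with \<open>c \<noteq> 0\<close> is the product of an upper, a lower and an upper transvection, by Gaussian
  elimination with the pivot \<open>c\<close>. If \<open>c = 0\<close>, then adding the first row to the second makes the
  lower left entry nonzero.
\<close>

lemma generated_by_transvections:
  assumes N: "subgroup N (SL2 F)"
    and low: "\<And>t. t \<in> F \<Longrightarrow> (1, 0, t, 1) \<in> N" and up: "\<And>t. t \<in> F \<Longrightarrow> (1, t, 0, 1) \<in> N"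
  shows "N = carrier (SL2 F)"
proof
  interpret subgroup N "SL2 F" by fact
  have gen: "(a, b, c, d) \<in> N" if "(a, b, c, d) \<in> carrier (SL2 F)" "c \<noteq> 0" for a b c d
  proof -
    have F: "a \<in> F" "c \<in> F" "d \<in> F" and det: "a * d + b * c = 1"
      using that by (auto simp: SL2_carrier)
    have "b * c = 1 + a * d" using det by (metis add.commute add_eq_zero_iff add.left_commute add_self add_0_right)
    then have b: "b = (1 + a * d) / c" using that by (simp add: eq_divide_eq)
    have "(1, (a + 1) / c, 0, 1) \<otimes>\<^bsub>SL2 F\<^esub> (1, 0, c, 1) \<otimes>\<^bsub>SL2 F\<^esub> (1, (d + 1) / c, 0, 1) \<in> N"
      using F by (intro m_closed low up) (simp_all add: F_closed)
    moreover have "a * ((d + 1) / c) + (a + 1) / c = b"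
    proof -
      have "a * ((d + 1) / c) + (a + 1) / c = (1 + a * d + (a + a)) / c"
        by (simp add: add_divide_distrib algebra_simps)
      then show ?thesis by (simp add: b add_self)
    qed
    moreover have "1 + (a + 1) = a" "d + 1 + 1 = d" using one_add_one by (simp_all add: add.assoc add.left_commute)
    ultimately show ?thesis using that(2) by simp
  qed
  show "carrier (SL2 F) \<subseteq> N"
  proof clarify
    fix a b c d assume m: "(a, b, c, d) \<in> carrier (SL2 F)"
    show "(a, b, c, d) \<in> N"
    proof (cases "c = 0")
      case True
      with m have "a \<noteq> 0" "a \<in> F" "b \<in> F" "d \<in> F" "a * d = 1" by (auto simp: SL2_carrier)
      then have "(a, b, a, b + d) \<in> N"
        by (intro gen) (simp_all add: SL2_carrier F_closed algebra_simps two_eq_zero)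
      then have "(1, 0, 1, 1) \<otimes>\<^bsub>SL2 F\<^esub> (a, b, a, b + d) \<in> N"
        using low[OF one_mem] by blast
      then show ?thesis using True by (simp add: add_self flip: add.assoc)
    qed (use gen m in blast)
  qed
qed (use N subgroup.subset in blast)

lemma normal_swap:
  assumes "N \<lhd> SL2 F" "(a, b, c, d) \<in> N"
  shows "(d, c, b, a) \<in> N"
proof -
  interpret normal N "SL2 F" by fact
  have w: "(0, 1, 1, 0) \<in> carrier (SL2 F)" by (simp add: SL2_carrier F_closed)
  show ?thesis
    using inv_op_closed2[OF w assms(2)] by (simp add: SL2_inv[OF w])
qed

text \<open>
  Conjugation by an upper transvection makes the upper left entry zero. For such a matrix the
  commutator with the diagonal matrix of \<open>e\<close> and its inverse is lower triangular.
\<close>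

lemma normal_imp_triangular:
  assumes N: "N \<lhd> SL2 F" and m: "(p, q, r, s) \<in> N" and "r \<noteq> 0"
    and e: "e \<in> F" "e \<noteq> 0"
  shows "\<exists>s' v. (e * e, 0, s', v) \<in> N"
proof -
  interpret normal N "SL2 F" by fact
  have M: "(p, q, r, s) \<in> carrier (SL2 F)" using m subset by blast
  then have F: "p \<in> F" "q \<in> F" "r \<in> F" "s \<in> F" by (auto simp: SL2_carrier)
  have E: "(1, p / r, 0, 1) \<in> carrier (SL2 F)" using F by (simp add: SL2_carrier F_closed)
  obtain b t where c: "(0, b, r, t) \<in> N"
    using inv_op_closed2[OF E m] \<open>r \<noteq> 0\<close> by (simp add: SL2_inv[OF E] add_self)
  have C: "(0, b, r, t) \<in> carrier (SL2 F)" using c subset by blast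
  have D: "(e, 0, 0, inverse e) \<in> carrier (SL2 F)" using e by (simp add: SL2_carrier F_closed inverse_mem)
  have "b * r = 1" using C by (simp add: SL2_carrier)
  moreover have "(e, 0, 0, inverse e) \<otimes>\<^bsub>SL2 F\<^esub> (0, b, r, t) \<otimes>\<^bsub>SL2 F\<^esub> inv\<^bsub>SL2 F\<^esub> (e, 0, 0, inverse e)
      \<otimes>\<^bsub>SL2 F\<^esub> inv\<^bsub>SL2 F\<^esub> (0, b, r, t) \<in> N"
    using inv_op_closed2[OF D c] c by blast
  moreover have "e * b * e * r = e * e * (b * r)" by (simp add: mult_ac)
  ultimately show ?thesis
    by (auto simp: SL2_inv[OF C] SL2_inv[OF D])
qed

text \<open>
  Every nontrivial matrix leads to a triangular one whose diagonal is not \<open>(1, 1)\<close>, and then all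
  transvections follow. Here \<open>e\<^sup>2 \<noteq> 1\<close> for the given \<open>e \<noteq> 1\<close>, because squaring is injective in
  characteristic 2; such an \<open>e \<noteq> 0\<close> exists only in fields with more than two elements, in
  accordance with the solubility of the group over the field of two elements.
\<close>

lemma nontrivial_normal_full:
  assumes N: "N \<lhd> SL2 F" and m: "(p, q, r, s) \<in> N" "(p, q, r, s) \<noteq> \<one>\<^bsub>SL2 F\<^esub>"
    and e: "e \<in> F" "e \<noteq> 0" "e \<noteq> 1"
  shows "N = carrier (SL2 F)"
proof -
  have ee: "e * e \<noteq> 1" using \<open>e \<noteq> 1\<close> square_eq_1_iff[of e] unfolding minus_eq by blast
  consider "r \<noteq> 0" | "q \<noteq> 0" | "q = 0" "r = 0" by blast
  then obtain u s' v where u: "(u, 0, s', v) \<in> N" "u \<noteq> 1"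
  proof cases
    case 1
    then show ?thesis using normal_imp_triangular[OF N m(1) 1 e(1,2)] ee that by blast
  next
    case 2
    show ?thesis using normal_imp_triangular[OF N normal_swap[OF N m(1)] 2 e(1,2)] ee that by blast
  next
    case 3
    have "(p, q, r, s) \<in> carrier (SL2 F)"
      using m(1) subgroup.subset[OF normal_imp_subgroup[OF N]] by blast
    then have "p * s = 1" using 3 by (simp add: SL2_carrier)
    then have "p \<noteq> 1" using m(2) 3 by (auto simp: SL2_one)
    then show ?thesis using that m(1) 3 by metis
  qed
  have low: "(1, 0, t, 1) \<in> N" if "t \<in> F" for t
    using normal_triangular_imp_transvections[OF N u that] .
  show ?thesis
    using normal_imp_subgroup[OF N] low normal_swap[OF N low] by (rule generated_by_transvections)
qed

lemma simple_group_SL2: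
  assumes "finite F" and e: "e \<in> F" "e \<noteq> 0" "e \<noteq> 1"
  shows "simple_group (SL2 F)"
proof (intro simple_group.intro simple_group_axioms.intro group_SL2)
  have "carrier (SL2 F) \<subseteq> F \<times> F \<times> F \<times> F" by (auto simp: SL2_def)
  then have "finite (carrier (SL2 F))"
    by (rule finite_subset) (simp add: \<open>finite F\<close>)
  moreover have "{(1, 0, 0, 1), (0, 1, 1, 0)} \<subseteq> carrier (SL2 F)"
    by (simp add: SL2_carrier F_closed)
  ultimately have "card {(1, 0, 0, 1), (0, 1, 1, 0) :: 'a \<times> 'a \<times> 'a \<times> 'a} \<le> Coset.order (SL2 F)"
    unfolding Coset.order_def by (rule card_mono)
  then show "1 < Coset.order (SL2 F)" by simp
next
  fix N assume N: "N \<lhd> SL2 F"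
  show "N = carrier (SL2 F) \<or> N = {\<one>\<^bsub>SL2 F\<^esub>}"
  proof (cases "N \<subseteq> {\<one>\<^bsub>SL2 F\<^esub>}")
    case True
    then show ?thesis using subgroup.one_closed[OF normal_imp_subgroup[OF N]] by blast
  next
    case False
    then obtain m where m: "m \<in> N" "m \<noteq> \<one>\<^bsub>SL2 F\<^esub>" by blast
    obtain p q r s where "m = (p, q, r, s)" by (rule prod_cases4)
    with m nontrivial_normal_full[OF N _ _ e] show ?thesis by simp
  qed
qed

end

section \<open>Transport to groups of natural numbers\<close>

lemma finite_group_iso_nat_group:
  assumes "group G" "finite (carrier G)"
  obtains T :: "nat monoid" and \<phi> where "group T" "\<phi> \<in> iso G T"
proof -
  interpret group G by fact
  obtain h :: "'a \<Rightarrow> nat" where h: "inj_on h (carrier G)"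
    using finite_imp_inj_to_nat_seg[OF assms(2)] by blast
  define h' where "h' = inv_into (carrier G) h"
  define T where "T = \<lparr>carrier = h ` carrier G, monoid.mult = \<lambda>x y. h (h' x \<otimes>\<^bsub>G\<^esub> h' y), one = h \<one>\<^bsub>G\<^esub>\<rparr>"
  have h'_h: "h' (h x) = x" if "x \<in> carrier G" for x using h that by (simp add: h'_def)
  have "group T"
  proof (rule groupI)
    show "\<exists>y\<in>carrier T. y \<otimes>\<^bsub>T\<^esub> x = \<one>\<^bsub>T\<^esub>" if x: "x \<in> carrier T" for x
    proof -
      obtain z where "z \<in> carrier G" "x = h z" using x by (auto simp: T_def)
      then show ?thesis by (intro bexI[of _ "h (inv\<^bsub>G\<^esub> z)"]) (simp_all add: T_def h'_h)
    qed
  qed (auto simp: T_def h'_h m_assoc)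
  moreover have "h \<in> iso G T"
    using h by (auto simp: iso_def hom_def bij_betw_def T_def h'_h)
  ultimately show ?thesis using that by blast
qed

lemma commutation_transitive_iso:
  assumes \<phi>: "\<phi> \<in> iso G H" and "group G" "group H" and CT: "commutation_transitive G"
  shows "commutation_transitive H"
  unfolding commutation_transitive_def
proof (intro ballI impI, elim conjE)
  fix x y z
  assume *: "x \<in> carrier H" "y \<in> carrier H" "z \<in> carrier H"
    and z: "z \<noteq> \<one>\<^bsub>H\<^esub>" "x \<otimes>\<^bsub>H\<^esub> z = z \<otimes>\<^bsub>H\<^esub> x" "y \<otimes>\<^bsub>H\<^esub> z = z \<otimes>\<^bsub>H\<^esub> y"
  define \<psi> where "\<psi> = inv_into (carrier G) \<phi>"
  have \<psi>: "\<psi> \<in> iso H G" using \<phi> group.iso_set_sym[OF \<open>group G\<close>] by (simp add: \<psi>_def)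
  have inj: "inj_on \<psi> (carrier H)" using \<psi> by (auto simp: iso_def bij_betw_def)
  have hom: "\<psi> (u \<otimes>\<^bsub>H\<^esub> v) = \<psi> u \<otimes>\<^bsub>G\<^esub> \<psi> v" if "u \<in> carrier H" "v \<in> carrier H" for u v
    using \<psi> that by (auto simp: iso_def hom_def)
  have mem: "\<psi> u \<in> carrier G" if "u \<in> carrier H" for u
    using \<psi> that by (auto simp: iso_def hom_def)
  have one: "\<psi> \<one>\<^bsub>H\<^esub> = \<one>\<^bsub>G\<^esub>"
    using \<psi> hom_one[OF _ \<open>group H\<close> \<open>group G\<close>] by (auto simp: iso_def)
  have mH: "u \<otimes>\<^bsub>H\<^esub> v \<in> carrier H" if "u \<in> carrier H" "v \<in> carrier H" for u v
    using that group.is_monoid[OF \<open>group H\<close>] by (simp add: monoid.m_closed)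
  have "\<psi> z \<noteq> \<one>\<^bsub>G\<^esub>"
    using z(1) one inj * group.is_monoid[OF \<open>group H\<close>] by (metis inj_onD monoid.one_closed)
  moreover have "\<psi> x \<otimes>\<^bsub>G\<^esub> \<psi> z = \<psi> z \<otimes>\<^bsub>G\<^esub> \<psi> x" "\<psi> y \<otimes>\<^bsub>G\<^esub> \<psi> z = \<psi> z \<otimes>\<^bsub>G\<^esub> \<psi> y"
    using z(2,3) * by (simp_all flip: hom)
  ultimately have "\<psi> x \<otimes>\<^bsub>G\<^esub> \<psi> y = \<psi> y \<otimes>\<^bsub>G\<^esub> \<psi> x"
    using CT mem * unfolding commutation_transitive_def by blast
  then have "\<psi> (x \<otimes>\<^bsub>H\<^esub> y) = \<psi> (y \<otimes>\<^bsub>H\<^esub> x)" using * by (simp add: hom)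
  then show "x \<otimes>\<^bsub>H\<^esub> y = y \<otimes>\<^bsub>H\<^esub> x" using inj mH * by (meson inj_onD)
qed

lemma S3_generators_iso:
  assumes \<phi>: "\<phi> \<in> iso G H" and "group G" "group H" and xy: "S3_generators G x y"
  shows "S3_generators H (\<phi> x) (\<phi> y)"
proof -
  interpret G: group G by fact
  have inj: "inj_on \<phi> (carrier G)" and hom: "\<phi> \<in> hom G H" using \<phi> by (auto simp: iso_def bij_betw_def)
  have one: "\<phi> \<one>\<^bsub>G\<^esub> = \<one>\<^bsub>H\<^esub>" using hom_one[OF hom \<open>group G\<close> \<open>group H\<close>] .
  have *: "x \<in> carrier G" "y \<in> carrier G" "x \<otimes>\<^bsub>G\<^esub> x = \<one>\<^bsub>G\<^esub>" "y \<otimes>\<^bsub>G\<^esub> y = \<one>\<^bsub>G\<^esub>"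
      "x \<otimes>\<^bsub>G\<^esub> y \<otimes>\<^bsub>G\<^esub> x = y \<otimes>\<^bsub>G\<^esub> x \<otimes>\<^bsub>G\<^esub> y" "x \<noteq> y"
    using xy by (auto simp: S3_generators_def)
  then have "\<phi> x \<noteq> \<phi> y" using inj by (metis inj_onD)
  then show ?thesis
    unfolding S3_generators_def using * hom_in_carrier[OF hom] one
    by (simp flip: hom_mult[OF hom])
qed

lemma (in char_two_subfield) S3_generators_SL2:
  "S3_generators (SL2 F) (0, 1, 1, 0) (1, 1, 0, 1)"
  by (simp add: S3_generators_def SL2_carrier SL2_one F_closed two_eq_zero)

lemma CHAR_bit: "CHAR(bit) = 2"
  by (rule CHAR_eq_posI) (auto simp: less_2_cases_iff)

text \<open>
  The groups are copies of \<open>SL\<^sub>2\<close> over the field of order \<open>2\<^sup>n\<^sup>+\<^sup>2\<close>; the shift by 2 ensures that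
  the field has more than two elements.
\<close>

lemma large_simple_commutation_transitive_group:
  obtains T :: "nat monoid" and x y
  where "simple_group T" "commutation_transitive T" "S3_generators T x y" "n \<le> card (carrier T)"
proof -
  define F where "F = {x :: bit alg_closure. x ^ (2 ^ (n + 2)) = x}"
  have char: "CHAR(bit alg_closure) = 2" by (simp add: CHAR_bit)
  interpret char_two_subfield F unfolding F_def using frobenius_fixed_points_subfield[OF char] .
  have card_F: "card F = 2 ^ (n + 2)"
    unfolding F_def by (rule card_fixed_points_frobenius_power[OF char]) simp
  have "finite F" by (rule card_ge_0_finite) (simp add: card_F)
  have "\<not> F \<subseteq> {0, 1}"
  proof
    assume "F \<subseteq> {0, 1}"
    then have "card F \<le> card {0, 1 :: bit alg_closure}" by (rule card_mono[rotated]) simp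
    also have "\<dots> \<le> 2" by simp
    also have "(2::nat) < 2 ^ (n + 2)" using power_strict_increasing[of 1 "n + 2" "2::nat"] by simp
    finally show False by (simp add: card_F)
  qed
  then obtain e where e: "e \<in> F" "e \<noteq> 0" "e \<noteq> 1" by blast
  have simple: "simple_group (SL2 F)" by (rule simple_group_SL2[OF \<open>finite F\<close> e])
  have fin: "finite (carrier (SL2 F))"
    using simple_group.order_gt_one[OF simple] by (simp add: Coset.order_def card_ge_0_finite)
  obtain T :: "nat monoid" and \<phi> where T: "group T" "\<phi> \<in> iso (SL2 F) T"
    by (rule finite_group_iso_nat_group[OF group_SL2 fin])
  show ?thesis
  proof (rule that)
    show "simple_group T" by (rule simple_group.iso_simple[OF simple T])
    show "commutation_transitive T"
      by (rule commutation_transitive_iso[OF T(2) group_SL2 T(1) commutation_transitive_SL2])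
    show "S3_generators T (\<phi> (0, 1, 1, 0)) (\<phi> (1, 1, 0, 1))"
      by (rule S3_generators_iso[OF T(2) group_SL2 T(1) S3_generators_SL2])
    have "n \<le> card F" using card_F less_exp[of "n + 2"] by simp
    also have "card F \<le> card (carrier (SL2 F))"
      by (rule card_inj_on_le[OF _ _ fin, where f = "\<lambda>t. (1, t, 0, 1)"])
        (auto simp: inj_on_def SL2_carrier F_closed)
    also have "\<dots> = card (carrier T)"
      using T(2) by (auto simp: iso_def intro: bij_betw_same_card)
    finally show "n \<le> card (carrier T)" .
  qed
qed

section \<open>Infinitely many diagonal type groups\<close>

text \<open>
  By commutation transitivity, the centre of a nonabelian group is trivial, so the description of the
  action of \<open>T\<^sup>2\<close> on the cosets as two-sided multiplication applies.
\<close>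

lemma diagonal_group_RC_4:
  fixes T :: "nat monoid"
  assumes "simple_group T" and CT: "commutation_transitive T" and xy: "S3_generators T x y"
  obtains \<Omega> G where "diagonal_type \<Omega> G" "RC \<Omega> G = 4" "card \<Omega> = card (carrier T)"
    "subgroup G (BijGroup \<Omega>)"
proof -
  interpret simple_group T by fact
  have xy': "x \<in> carrier T" "y \<in> carrier T" "x \<otimes>\<^bsub>T\<^esub> y \<noteq> y \<otimes>\<^bsub>T\<^esub> x"
    using xy S3_generators_noncommuting[OF xy] by (auto simp: S3_generators_def)
  interpret centerless_group T
  proof
    fix z assume z: "z \<in> carrier T" "\<And>x. x \<in> carrier T \<Longrightarrow> x \<otimes>\<^bsub>T\<^esub> z = z \<otimes>\<^bsub>T\<^esub> x"
    show "z = \<one>\<^bsub>T\<^esub>"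
      using CT[unfolded commutation_transitive_def, rule_format, OF xy'(1,2) z(1)] z(2) xy' by blast
  qed
  interpret two_sided_action T diag_point "diag_points 2 T" Tk_perms
  proof
    show "\<exists>a\<in>carrier T. \<exists>b\<in>carrier T. \<forall>t\<in>carrier T.
        g (diag_point t) = diag_point (inv\<^bsub>T\<^esub> a \<otimes>\<^bsub>T\<^esub> t \<otimes>\<^bsub>T\<^esub> b)" if "g \<in> Tk_perms" for g
      using that by (rule Tk_permsE) (auto simp: diag_perm_inn_pair)
    show "\<exists>g\<in>Tk_perms. \<forall>t\<in>carrier T.
        g (diag_point t) = diag_point (inv\<^bsub>T\<^esub> a \<otimes>\<^bsub>T\<^esub> t \<otimes>\<^bsub>T\<^esub> b)"
      if "a \<in> carrier T" "b \<in> carrier T" for a b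
      using Tk_permsI[OF that] by (rule bexI[rotated]) (simp add: diag_perm_inn_pair that)
  qed (rule bij_diag_point)
  have "finite (carrier T)"
    using order_gt_one by (simp add: Coset.order_def card_ge_0_finite)
  moreover have "\<not> comm_group T"
    using xy' comm_groupE(4)[of T x y] by blast
  ultimately have "diagonal_type (diag_points 2 T) Tk_perms"
    unfolding diagonal_type_def
    using is_simple_group subgroup_Tk_perms normal_Tk_perms Tk_perms_subset
    by (intro exI[of _ 2] exI[of _ T]) simp
  moreover have "RC (diag_points 2 T) Tk_perms = 4"
    by (rule RC_eq_4[OF CT xy])
  moreover have "card (diag_points 2 T) = card (carrier T)"
    using bij_betw_same_card[OF bij_diag_point] by simp
  ultimately show ?thesis using that subgroup_Tk_perms by blast
qed

lemma perm_iso_refl: "subgroup G (BijGroup \<Omega>) \<Longrightarrow> ((\<Omega>, G), (\<Omega>, G)) \<in> perm_iso"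
  unfolding perm_iso_def
  by (auto intro!: exI[of _ id] simp: iso_def hom_def bij_betw_def subgroup.m_closed)

lemma perm_iso_same_degree: "((\<Omega>, G), (\<Omega>', G')) \<in> perm_iso \<Longrightarrow> card \<Omega> = card \<Omega>'"
  unfolding perm_iso_def by (auto intro: bij_betw_same_card)

text \<open>
  Isomorphic permutation groups have the same degree. So if there were only finitely many
  isomorphism classes, then the degrees would be bounded, whereas the degree of the group obtained
  from \<open>T\<close> is the order of \<open>T\<close>.
\<close>

theorem proposition5p1:
  shows "infinite ({(\<Omega>, G). diagonal_type \<Omega> G \<and> RC \<Omega> G = 4} // perm_iso)"
proof
  let ?S = "{(\<Omega>, G). diagonal_type \<Omega> G \<and> RC \<Omega> G = 4}"
  \<comment> \<open>The degree of a class; any representative will do.\<close>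
  define deg where "deg K = card (fst (SOME z. z \<in> K))"
    for K :: "(nat diag_elt set set \<times> (nat diag_elt set \<Rightarrow> nat diag_elt set) set) set"
  assume "finite (?S // perm_iso)"
  then have "finite (deg ` (?S // perm_iso))" by simp
  then obtain n where n: "\<And>C. C \<in> ?S // perm_iso \<Longrightarrow> deg C \<le> n"
    by (auto simp: finite_nat_set_iff_bounded_le)
  obtain T :: "nat monoid" and x y
    where T: "simple_group T" "commutation_transitive T" "S3_generators T x y" "Suc n \<le> card (carrier T)"
    by (rule large_simple_commutation_transitive_group)
  obtain \<Omega> G where G: "diagonal_type \<Omega> G" "RC \<Omega> G = 4" "card \<Omega> = card (carrier T)"
    "subgroup G (BijGroup \<Omega>)"
    by (rule diagonal_group_RC_4[OF T(1-3)])
  let ?C = "perm_iso `` {(\<Omega>, G)}"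
  have C: "?C \<in> ?S // perm_iso" using G(1,2) by (intro quotientI) simp
  have "(SOME z. z \<in> ?C) \<in> ?C"
    by (rule someI[of _ "(\<Omega>, G)"]) (simp add: perm_iso_refl[OF G(4)])
  then have "deg ?C = card \<Omega>"
    unfolding deg_def by (cases "SOME z. z \<in> ?C") (auto dest: perm_iso_same_degree)
  then show False using n[OF C] G(3) T(4) by simp
qed

end
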